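(* Let $X$ be a discrete metric space with bounded geometry. Then the $\ell^1$ uniform Roe algebra $B^1_u(X)$ is $1$-nuclear.
   Context: Scalars are complex. Bounded geometry: a metric space $(X,d)$ has bounded geometry if for every $R\ge 0$ there is $N_R\in\mathbb{N}$ such that every ball of radius $R$ in $X$ has at most $N_R$ elements. $\ell^1$ uniform Roe algebra: for $T\in B(\ell^1(X))$ let $T_{xy}=\langle T\delta_y,\delta_x\rangle$ and $\mathrm{prop}(T)=\sup\{d(x,y):T_{xy}\ne 0\}\in[0,\infty]$. $B^1_u(X)$ is the operator norm closure in $B(\ell^1(X))$ of the algebra of all $T\in B(\ell^1(X))$ with finite propagation. $1$-nuclearity: an $L^1$-operator algebra is a norm-closed subalgebra $A$ of $B(L^1(\mu))$ for some measure $\mu$; it carries the matrix norms given by $M_n(A)\subseteq B(L^1(\mu)^{\oplus n})$, where $L^1(\mu)^{\oplus n}$ is the $\ell^1$-direct sum. $M_n^1$ denotes $M_n(\mathbb{C})=B(\ell^1_n)$, where $\ell^1_n$ is $\mathbb{C}^n$ with the $\ell^1$ norm. A linear map $\phi:V\to W$ between such spaces is a $1$-complete contraction if all amplifications $\phi_n:M_n(V)\to M_n(W)$, $[x_{ij}]\mapsto[\phi(x_{ij})]$, satisfy $\|\phi_n\|\le 1$. $A$ is $1$-nuclear if there are nets of $1$-complete contractions $\phi_\alpha:A\to M^1_{n(\alpha)}$ and $\psi_\alpha:M^1_{n(\alpha)}\to A$ with $\|\psi_\alpha\circ\phi_\alpha(a)-a\|\to 0$ for all $a\in A$. *)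

theory Defs
  imports "HOL-Analysis.Analysis"
begin

text \<open>
  The Banach space \<open>L\<^sup>1(\<mu>)\<close> is handled through representatives: its elements are the integrable
  complex functions, with the \<open>L\<^sup>1\<close> seminorm, and functions that agree almost everywhere are
  identified.  Accordingly, a bounded operator on \<open>L\<^sup>1(\<mu>)\<close> is represented by a map on integrable
  functions that is linear up to almost everywhere equality and bounded; two such maps represent
  the same operator iff \<open>L1_op_eq\<close> holds.  (A bounded map of this kind respects almost everywhere
  equality, and every bounded operator on the quotient has such a representative.)
  Equations between operators are therefore always stated with \<open>L1_op_eq\<close>.
\<close>

type_synonym 'a fn_op = "('a \<Rightarrow> complex) \<Rightarrow> ('a \<Rightarrow> complex)"

definition L1 :: "'a measure \<Rightarrow> ('a \<Rightarrow> complex) set" where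
  "L1 M = {f. integrable M f}"

definition L1_norm :: "'a measure \<Rightarrow> ('a \<Rightarrow> complex) \<Rightarrow> real" where
  "L1_norm M f = (LINT x|M. norm (f x))"

definition L1_ops :: "'a measure \<Rightarrow> 'a fn_op set" where
  "L1_ops M = {T.
     (\<forall>f\<in>L1 M. T f \<in> L1 M) \<and>
     (\<forall>f\<in>L1 M. \<forall>g\<in>L1 M. AE x in M. T (\<lambda>y. f y + g y) x = T f x + T g x) \<and>
     (\<forall>c. \<forall>f\<in>L1 M. AE x in M. T (\<lambda>y. c * f y) x = c * T f x) \<and>
     (\<exists>K. \<forall>f\<in>L1 M. L1_norm M (T f) \<le> K * L1_norm M f)}"

definition L1_op_eq :: "'a measure \<Rightarrow> 'a fn_op \<Rightarrow> 'a fn_op \<Rightarrow> bool" where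
  "L1_op_eq M S T \<longleftrightarrow> (\<forall>f\<in>L1 M. AE x in M. S f x = T f x)"

definition op_add :: "'a fn_op \<Rightarrow> 'a fn_op \<Rightarrow> 'a fn_op" where
  "op_add S T = (\<lambda>f x. S f x + T f x)"

definition op_diff :: "'a fn_op \<Rightarrow> 'a fn_op \<Rightarrow> 'a fn_op" where
  "op_diff S T = (\<lambda>f x. S f x - T f x)"

definition op_scale :: "complex \<Rightarrow> 'a fn_op \<Rightarrow> 'a fn_op" where
  "op_scale c T = (\<lambda>f x. c * T f x)"

definition L1_opnorm :: "'a measure \<Rightarrow> 'a fn_op \<Rightarrow> real" where
  "L1_opnorm M T = Sup {L1_norm M (T f) | f. f \<in> L1 M \<and> L1_norm M f \<le> 1}"

definition L1_op_closure :: "'a measure \<Rightarrow> 'a fn_op set \<Rightarrow> 'a fn_op set" where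
  "L1_op_closure M A =
     {T \<in> L1_ops M. \<forall>\<epsilon>>0. \<exists>S\<in>A. L1_opnorm M (op_diff T S) < \<epsilon>}"

definition L1_operator_algebra :: "'a measure \<Rightarrow> 'a fn_op set \<Rightarrow> bool" where
  "L1_operator_algebra M A \<longleftrightarrow>
     A \<subseteq> L1_ops M \<and> A \<noteq> {} \<and>
     (\<forall>S\<in>A. \<forall>T\<in>A. op_add S T \<in> A) \<and>
     (\<forall>c. \<forall>T\<in>A. op_scale c T \<in> A) \<and>
     (\<forall>S\<in>A. \<forall>T\<in>A. S \<circ> T \<in> A) \<and>
     L1_op_closure M A \<subseteq> A"

text \<open>
  The norm of the matrix \<open>[a i j]\<close>, \<open>i, j < n\<close>, acting on the \<open>\<ell>\<^sup>1\<close>-direct sum of \<open>n\<close> copies of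
  \<open>L\<^sup>1(\<mu>)\<close>.  Vectors and matrices are functions on \<open>nat\<close>, of which only the values at indices
  below \<open>n\<close> matter.
\<close>

definition L1_sum_norm :: "'a measure \<Rightarrow> nat \<Rightarrow> (nat \<Rightarrow> 'a \<Rightarrow> complex) \<Rightarrow> real" where
  "L1_sum_norm M n v = (\<Sum>i<n. L1_norm M (v i))"

definition matrix_apply ::
    "nat \<Rightarrow> (nat \<Rightarrow> nat \<Rightarrow> 'a fn_op) \<Rightarrow> (nat \<Rightarrow> 'a \<Rightarrow> complex) \<Rightarrow> (nat \<Rightarrow> 'a \<Rightarrow> complex)" where
  "matrix_apply n a v = (\<lambda>i x. \<Sum>j<n. a i j (v j) x)"

definition L1_matrix_norm :: "'a measure \<Rightarrow> nat \<Rightarrow> (nat \<Rightarrow> nat \<Rightarrow> 'a fn_op) \<Rightarrow> real" where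
  "L1_matrix_norm M n a =
     Sup {L1_sum_norm M n (matrix_apply n a v) | v.
            (\<forall>j<n. v j \<in> L1 M) \<and> L1_sum_norm M n v \<le> 1}"

text \<open>
  Linear maps \<open>\<phi>\<close> from \<open>V \<subseteq> B(L\<^sup>1(\<mu>))\<close> to \<open>W \<subseteq> B(L\<^sup>1(\<nu>))\<close>.  The condition \<open>\<parallel>\<phi>\<^sub>n\<parallel> \<le> 1\<close> is stated
  elementwise, because the supremum of a set of reals is only meaningful once the set is known
  to be bounded.
\<close>

definition complete_contraction_1 ::
    "'a measure \<Rightarrow> 'a fn_op set \<Rightarrow> 'b measure \<Rightarrow> 'b fn_op set \<Rightarrow> ('a fn_op \<Rightarrow> 'b fn_op) \<Rightarrow> bool" where
  "complete_contraction_1 M V N W \<phi> \<longleftrightarrow>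
     (\<forall>a\<in>V. \<phi> a \<in> W) \<and>
     (\<forall>a\<in>V. \<forall>b\<in>V. L1_op_eq N (\<phi> (op_add a b)) (op_add (\<phi> a) (\<phi> b))) \<and>
     (\<forall>c. \<forall>a\<in>V. L1_op_eq N (\<phi> (op_scale c a)) (op_scale c (\<phi> a))) \<and>
     (\<forall>n. \<forall>a. (\<forall>i<n. \<forall>j<n. a i j \<in> V) \<longrightarrow>
        L1_matrix_norm N n (\<lambda>i j. \<phi> (a i j)) \<le> L1_matrix_norm M n a)"

abbreviation fin_measure :: "nat \<Rightarrow> nat measure" where
  "fin_measure n \<equiv> count_space {..<n}"

text \<open>\<open>M\<^sub>n\<^sup>1 = B(\<ell>\<^sup>1\<^sub>n)\<close>, where \<open>\<ell>\<^sup>1\<^sub>n\<close> is \<open>L\<^sup>1\<close> of the counting measure on \<open>{0, \<dots>, n - 1}\<close>.\<close>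

definition M1 :: "nat \<Rightarrow> nat fn_op set" where
  "M1 n = L1_ops (fin_measure n)"

definition directed_preorder :: "'i set \<Rightarrow> 'i rel \<Rightarrow> bool" where
  "directed_preorder I r \<longleftrightarrow>
     I \<noteq> {} \<and> preorder_on I r \<and> (\<forall>a\<in>I. \<forall>b\<in>I. \<exists>c\<in>I. (a, c) \<in> r \<and> (b, c) \<in> r)"

text \<open>
  A definition cannot quantify over the type of the indices of a net, so the indices are taken
  from \<open>'a fn_op set \<times> nat\<close>.  This is no restriction: a net with an arbitrary directed index
  set yields one indexed by the pairs of a finite \<open>F \<subseteq> A\<close> and \<open>k :: nat\<close>, by picking for \<open>(F, k)\<close>
  an index at which the norms for all \<open>a \<in> F\<close> are below \<open>1 / (k + 1)\<close>.
\<close>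

definition nuclear_1 :: "'a measure \<Rightarrow> 'a fn_op set \<Rightarrow> bool" where
  "nuclear_1 M A \<longleftrightarrow>
     L1_operator_algebra M A \<and>
     (\<exists>(I :: ('a fn_op set \<times> nat) set) r n \<phi> \<psi>.
        directed_preorder I r \<and>
        (\<forall>\<alpha>\<in>I. n \<alpha> \<ge> 1 \<and>
           complete_contraction_1 M A (fin_measure (n \<alpha>)) (M1 (n \<alpha>)) (\<phi> \<alpha>) \<and>
           complete_contraction_1 (fin_measure (n \<alpha>)) (M1 (n \<alpha>)) M A (\<psi> \<alpha>)) \<and>
        (\<forall>a\<in>A. \<forall>\<epsilon>>0. \<exists>\<alpha>\<in>I. \<forall>\<beta>\<in>I. (\<alpha>, \<beta>) \<in> r \<longrightarrow>
           L1_opnorm M (op_diff (\<psi> \<beta> (\<phi> \<beta> a)) a) < \<epsilon>))"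

definition delta :: "'a \<Rightarrow> 'a \<Rightarrow> complex" where
  "delta y = (\<lambda>x. if x = y then 1 else 0)"

text \<open>\<open>T\<^sub>x\<^sub>y = \<langle>T \<delta>\<^sub>y, \<delta>\<^sub>x\<rangle>\<close> is the value of \<open>T \<delta>\<^sub>y\<close> at \<open>x\<close>.\<close>

definition coefficient :: "'a fn_op \<Rightarrow> 'a \<Rightarrow> 'a \<Rightarrow> complex" where
  "coefficient T x y = T (delta y) x"

context Metric_space
begin

definition bounded_geometry :: bool where
  "bounded_geometry \<longleftrightarrow>
     (\<forall>R\<ge>0. \<exists>N::nat. \<forall>x\<in>M. finite (mcball x R) \<and> card (mcball x R) \<le> N)"

text \<open>Valued in \<open>ennreal\<close>, so that the supremum over the empty set is \<open>0\<close>.\<close>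

definition propagation :: "'a fn_op \<Rightarrow> ennreal" where
  "propagation T =
     Sup {ennreal (d x y) | x y. x \<in> M \<and> y \<in> M \<and> coefficient T x y \<noteq> 0}"

definition uniform_Roe_algebra_1 :: "'a fn_op set" where
  "uniform_Roe_algebra_1 =
     L1_op_closure (count_space M) {T \<in> L1_ops (count_space M). propagation T < \<infinity>}"

end

end

theory Submission
  imports Defs
begin

text \<open>
  The norm of a matrix over \<open>B(\<ell>\<^sup>1(X))\<close> is the supremum of the \<open>\<ell>\<^sup>1\<close>-norms of its columns, so a
  linear map that sends each column of its values to something dominated by a single column of the
  argument is a \<open>1\<close>-complete contraction.  Given finitely many operators in the algebra, choose \<open>R\<close>
  such that every column is, up to \<open>\<epsilon>\<close>, supported in the ball of radius \<open>R\<close> around its index.  By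
  bounded geometry these balls have at most \<open>N\<close> points; numbering the points of each ball turns
  columns into vectors of \<open>\<ell>\<^sup>1\<^sub>N\<close>.  These vectors stay bounded, hence \<open>X\<close> splits into finitely many
  classes on which the columns of all the given operators are nearly constant.  Now \<open>\<phi>\<close> keeps one
  column from each class, and \<open>\<psi>\<close> copies that column back to all members of the class, through the
  numbering of their balls.
\<close>

section \<open>Operators on \<open>L\<^sup>1\<close>\<close>

lemma L1_add: "f \<in> L1 M \<Longrightarrow> g \<in> L1 M \<Longrightarrow> (\<lambda>x. f x + g x) \<in> L1 M"
  by (simp add: L1_def)

lemma L1_diff: "f \<in> L1 M \<Longrightarrow> g \<in> L1 M \<Longrightarrow> (\<lambda>x. f x - g x) \<in> L1 M"
  by (simp add: L1_def)

lemma L1_scale: "f \<in> L1 M \<Longrightarrow> (\<lambda>x. c * f x) \<in> L1 M"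
  by (simp add: L1_def)

lemma L1_zero: "(\<lambda>x. 0) \<in> L1 M"
  by (simp add: L1_def)

lemma L1_sum: "(\<And>j. j \<in> J \<Longrightarrow> f j \<in> L1 M) \<Longrightarrow> (\<lambda>x. \<Sum>j\<in>J. f j x) \<in> L1 M"
  by (simp add: L1_def)

lemma L1_norm_nonneg: "0 \<le> L1_norm M f"
  by (simp add: L1_norm_def)

lemma L1_norm_zero: "L1_norm M (\<lambda>x. 0) = 0"
  by (simp add: L1_norm_def)

lemma L1_norm_scale: "L1_norm M (\<lambda>x. c * f x) = norm c * L1_norm M f"
  by (simp add: L1_norm_def norm_mult)

lemma L1_norm_add:
  assumes "f \<in> L1 M" "g \<in> L1 M"
  shows "L1_norm M (\<lambda>x. f x + g x) \<le> L1_norm M f + L1_norm M g"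
proof -
  have "L1_norm M (\<lambda>x. f x + g x) \<le> (LINT x|M. norm (f x) + norm (g x))"
    unfolding L1_norm_def using assms
    by (intro integral_mono) (auto simp: L1_def norm_triangle_ineq)
  also have "\<dots> = L1_norm M f + L1_norm M g"
    using assms by (simp add: L1_norm_def L1_def)
  finally show ?thesis .
qed

lemma L1_norm_sum:
  assumes "\<And>j. j \<in> J \<Longrightarrow> f j \<in> L1 M"
  shows "L1_norm M (\<lambda>x. \<Sum>j\<in>J. f j x) \<le> (\<Sum>j\<in>J. L1_norm M (f j))"
  using assms
proof (induction J rule: infinite_finite_induct)
  case (insert j J)
  then have "L1_norm M (\<lambda>x. f j x + (\<Sum>j\<in>J. f j x)) \<le> L1_norm M (f j) + L1_norm M (\<lambda>x. \<Sum>j\<in>J. f j x)"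
    by (intro L1_norm_add L1_sum) auto
  with insert show ?case by force
qed (auto simp: L1_norm_zero)

lemma L1_norm_cong_AE:
  assumes "f \<in> L1 M" "g \<in> L1 M" "AE x in M. f x = g x"
  shows "L1_norm M f = L1_norm M g"
  unfolding L1_norm_def using assms by (intro integral_cong_AE) (auto simp: L1_def)

lemma L1_norm_eq_0_iff:
  assumes "f \<in> L1 M"
  shows "L1_norm M f = 0 \<longleftrightarrow> (AE x in M. f x = 0)"
  using assms integral_nonneg_eq_0_iff_AE[of M "\<lambda>x. norm (f x)"]
  by (simp add: L1_norm_def L1_def)

section \<open>Bounded operators through representatives: sums, multiples, products\<close>

lemma L1_ops_L1: "T \<in> L1_ops M \<Longrightarrow> f \<in> L1 M \<Longrightarrow> T f \<in> L1 M"
  by (simp add: L1_ops_def)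

lemma L1_ops_add:
  "T \<in> L1_ops M \<Longrightarrow> f \<in> L1 M \<Longrightarrow> g \<in> L1 M \<Longrightarrow> AE x in M. T (\<lambda>y. f y + g y) x = T f x + T g x"
  by (simp add: L1_ops_def)

lemma L1_ops_scale:
  "T \<in> L1_ops M \<Longrightarrow> f \<in> L1 M \<Longrightarrow> AE x in M. T (\<lambda>y. c * f y) x = c * T f x"
  by (simp add: L1_ops_def)

lemma L1_ops_bound:
  assumes "T \<in> L1_ops M"
  obtains K where "K \<ge> 0" "\<And>f. f \<in> L1 M \<Longrightarrow> L1_norm M (T f) \<le> K * L1_norm M f"
proof -
  obtain K where K: "\<forall>f\<in>L1 M. L1_norm M (T f) \<le> K * L1_norm M f"
    using assms by (auto simp: L1_ops_def)
  show ?thesis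
  \<comment> \<open>\<open>L1_ops\<close> puts no sign on the bound, and \<open>K\<close> may be
    negative when the seminorm vanishes identically. Passing to \<open>\<bar>K\<bar>\<close> is
    harmless because the seminorm is nonnegative.\<close>
  proof (rule that[of "\<bar>K\<bar>"])
    fix f assume "f \<in> L1 M"
    then have "L1_norm M (T f) \<le> K * L1_norm M f" using K by blast
    also have "\<dots> \<le> \<bar>K\<bar> * L1_norm M f" by (intro mult_right_mono L1_norm_nonneg) auto
    finally show "L1_norm M (T f) \<le> \<bar>K\<bar> * L1_norm M f" .
  qed simp
qed

lemma L1_ops_zero:
  assumes "T \<in> L1_ops M"
  shows "AE x in M. T (\<lambda>y. 0) x = 0"
  using L1_ops_scale[OF assms L1_zero, of 0] by simp

text \<open>Boundedness is what forces null functions to go to null functions: \<open>f - g\<close>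
  has seminorm \<open>0\<close>, hence so has its image, and additivity at
  \<open>g + (f - g)\<close> transfers this to \<open>T f\<close> and \<open>T g\<close>.\<close>

lemma L1_ops_cong_AE:
  assumes T: "T \<in> L1_ops M" and fg: "f \<in> L1 M" "g \<in> L1 M" and eq: "AE x in M. f x = g x"
  shows "AE x in M. T f x = T g x"
proof -
  let ?h = "\<lambda>x. f x - g x"
  have h: "?h \<in> L1 M" using fg by (rule L1_diff)
  have "L1_norm M ?h = 0" using eq by (subst L1_norm_eq_0_iff[OF h]) auto
  then have "L1_norm M (T ?h) \<le> 0"
    using L1_ops_bound[OF T] h by (metis mult_zero_right)
  then have "L1_norm M (T ?h) = 0" using L1_norm_nonneg by (metis order_antisym)
  then have "AE x in M. T ?h x = 0" using L1_norm_eq_0_iff[OF L1_ops_L1[OF T h]] by simp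
  moreover have "AE x in M. T (\<lambda>y. g y + ?h y) x = T g x + T ?h x"
    using L1_ops_add[OF T fg(2) h] .
  ultimately show ?thesis by (auto simp: algebra_simps)
qed

lemma L1_opsI:
  assumes "\<And>f. f \<in> L1 M \<Longrightarrow> T f \<in> L1 M"
    and "\<And>f g. f \<in> L1 M \<Longrightarrow> g \<in> L1 M \<Longrightarrow> AE x in M. T (\<lambda>y. f y + g y) x = T f x + T g x"
    and "\<And>c f. f \<in> L1 M \<Longrightarrow> AE x in M. T (\<lambda>y. c * f y) x = c * T f x"
    and "\<And>f. f \<in> L1 M \<Longrightarrow> L1_norm M (T f) \<le> K * L1_norm M f"
  shows "T \<in> L1_ops M"
  using assms unfolding L1_ops_def by blast

lemma L1_ops_op_add:
  assumes S: "S \<in> L1_ops M" and T: "T \<in> L1_ops M"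
  shows "op_add S T \<in> L1_ops M"
proof -
  obtain K L where K: "\<And>f. f \<in> L1 M \<Longrightarrow> L1_norm M (S f) \<le> K * L1_norm M f"
    and L: "\<And>f. f \<in> L1 M \<Longrightarrow> L1_norm M (T f) \<le> L * L1_norm M f"
    using L1_ops_bound[OF S] L1_ops_bound[OF T] by metis
  show ?thesis
  proof (rule L1_opsI[where K = "K + L"])
    fix f assume f: "f \<in> L1 M"
    show "op_add S T f \<in> L1 M"
      unfolding op_add_def by (intro L1_add L1_ops_L1[OF S] L1_ops_L1[OF T] f)
    show "AE x in M. op_add S T (\<lambda>y. c * f y) x = c * op_add S T f x" for c
      using L1_ops_scale[OF S f, of c] L1_ops_scale[OF T f, of c]
      by eventually_elim (simp add: op_add_def algebra_simps)
    show "L1_norm M (op_add S T f) \<le> (K + L) * L1_norm M f"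
      using L1_norm_add[OF L1_ops_L1[OF S f] L1_ops_L1[OF T f]] K[OF f] L[OF f]
      by (simp add: op_add_def algebra_simps)
    fix g assume g: "g \<in> L1 M"
    show "AE x in M. op_add S T (\<lambda>y. f y + g y) x = op_add S T f x + op_add S T g x"
      using L1_ops_add[OF S f g] L1_ops_add[OF T f g]
      by eventually_elim (simp add: op_add_def)
  qed
qed

lemma L1_ops_op_scale:
  assumes T: "T \<in> L1_ops M"
  shows "op_scale c T \<in> L1_ops M"
proof -
  obtain K where K: "\<And>f. f \<in> L1 M \<Longrightarrow> L1_norm M (T f) \<le> K * L1_norm M f"
    using L1_ops_bound[OF T] by metis
  show ?thesis
  proof (rule L1_opsI[where K = "norm c * K"])
    fix f assume f: "f \<in> L1 M"
    show "op_scale c T f \<in> L1 M"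
      unfolding op_scale_def by (intro L1_scale L1_ops_L1[OF T] f)
    show "AE x in M. op_scale c T (\<lambda>y. b * f y) x = b * op_scale c T f x" for b
      using L1_ops_scale[OF T f, of b] by eventually_elim (simp add: op_scale_def)
    show "L1_norm M (op_scale c T f) \<le> norm c * K * L1_norm M f"
      using mult_left_mono[OF K[OF f], of "norm c"]
      by (simp add: op_scale_def L1_norm_scale mult.assoc)
    fix g assume g: "g \<in> L1 M"
    show "AE x in M. op_scale c T (\<lambda>y. f y + g y) x = op_scale c T f x + op_scale c T g x"
      using L1_ops_add[OF T f g] by eventually_elim (simp add: op_scale_def algebra_simps)
  qed
qed

lemma op_diff_eq: "op_diff S T = op_add S (op_scale (-1) T)"
  by (simp add: op_diff_def op_add_def op_scale_def)

lemma L1_ops_op_diff: "S \<in> L1_ops M \<Longrightarrow> T \<in> L1_ops M \<Longrightarrow> op_diff S T \<in> L1_ops M"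
  by (simp add: op_diff_eq L1_ops_op_add L1_ops_op_scale)

lemma L1_ops_comp:
  assumes S: "S \<in> L1_ops M" and T: "T \<in> L1_ops M"
  shows "S \<circ> T \<in> L1_ops M"
proof -
  obtain K L where K0: "K \<ge> 0" and K: "\<And>f. f \<in> L1 M \<Longrightarrow> L1_norm M (S f) \<le> K * L1_norm M f"
    and L: "\<And>f. f \<in> L1 M \<Longrightarrow> L1_norm M (T f) \<le> L * L1_norm M f"
    using L1_ops_bound[OF S] L1_ops_bound[OF T] by metis
  note ST = L1_ops_L1[OF S] L1_ops_L1[OF T]
  show ?thesis
  proof (rule L1_opsI[where K = "K * L"])
    fix f assume f: "f \<in> L1 M"
    show "(S \<circ> T) f \<in> L1 M"
      using ST f by simp
    show "AE x in M. (S \<circ> T) (\<lambda>y. c * f y) x = c * (S \<circ> T) f x" for c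
      using L1_ops_cong_AE[OF S _ _ L1_ops_scale[OF T f, of c]] L1_ops_scale[OF S ST(2)[OF f], of c]
      by (auto simp: ST L1_scale f)
    have "L1_norm M (S (T f)) \<le> K * L1_norm M (T f)" using K ST f by simp
    also have "\<dots> \<le> K * (L * L1_norm M f)" using L f K0 by (intro mult_left_mono)
    finally show "L1_norm M ((S \<circ> T) f) \<le> K * L * L1_norm M f" by simp
    fix g assume g: "g \<in> L1 M"
    show "AE x in M. (S \<circ> T) (\<lambda>y. f y + g y) x = (S \<circ> T) f x + (S \<circ> T) g x"
      using L1_ops_cong_AE[OF S _ _ L1_ops_add[OF T f g]] L1_ops_add[OF S ST(2)[OF f] ST(2)[OF g]]
      by (auto simp: ST L1_add f g)
  qed
qed

section \<open>The operator norm\<close>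

lemma L1_opnorm_le:
  assumes "\<And>f. f \<in> L1 M \<Longrightarrow> L1_norm M f \<le> 1 \<Longrightarrow> L1_norm M (T f) \<le> C"
  shows "L1_opnorm M T \<le> C"
  unfolding L1_opnorm_def
proof (rule cSup_least)
  show "{L1_norm M (T f) |f. f \<in> L1 M \<and> L1_norm M f \<le> 1} \<noteq> {}"
    using L1_zero L1_norm_zero[of M] by force
qed (use assms in blast)

lemma L1_opnorm_upper:
  assumes T: "T \<in> L1_ops M" and g: "g \<in> L1 M" "L1_norm M g \<le> 1"
  shows "L1_norm M (T g) \<le> L1_opnorm M T"
proof -
  obtain K where K0: "K \<ge> 0" and K: "\<And>f. f \<in> L1 M \<Longrightarrow> L1_norm M (T f) \<le> K * L1_norm M f"
    using L1_ops_bound[OF T] by metis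
  show ?thesis
    unfolding L1_opnorm_def
  proof (rule cSup_upper)
    show "bdd_above {L1_norm M (T f) |f. f \<in> L1 M \<and> L1_norm M f \<le> 1}"
    proof (rule bdd_aboveI[where M = K], clarify)
      fix h assume "h \<in> L1 M" "L1_norm M h \<le> 1"
      then show "L1_norm M (T h) \<le> K" using K[of h] K0 mult_left_mono[of "L1_norm M h" 1 K] by auto
    qed
  qed (use g in blast)
qed

lemma L1_opnorm_nonneg:
  assumes "T \<in> L1_ops M"
  shows "0 \<le> L1_opnorm M T"
  using order_trans[OF L1_norm_nonneg L1_opnorm_upper[OF assms L1_zero]] by (simp add: L1_norm_zero)

text \<open>Normalising \<open>f\<close> reduces this to the unit ball. A function of seminorm
  \<open>0\<close> cannot be normalised; there any bound from \<open>L1_ops\<close> shows that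
  \<open>T f\<close> has seminorm \<open>0\<close> as well.\<close>

lemma L1_norm_le_opnorm:
  assumes T: "T \<in> L1_ops M" and f: "f \<in> L1 M"
  shows "L1_norm M (T f) \<le> L1_opnorm M T * L1_norm M f"
proof (cases "L1_norm M f = 0")
  case True
  then show ?thesis using L1_ops_bound[OF T] f by (metis mult_zero_right)
next
  case False
  then have pos: "L1_norm M f > 0" using L1_norm_nonneg[of M f] by simp
  define c where "c = complex_of_real (1 / L1_norm M f)"
  have c: "norm c = 1 / L1_norm M f" using pos by (simp add: c_def norm_divide)
  have "L1_norm M (T (\<lambda>x. c * f x)) = L1_norm M (\<lambda>x. c * T f x)"
    by (intro L1_norm_cong_AE L1_ops_scale[OF T] L1_ops_L1[OF T] L1_scale f)
  also have "\<dots> = L1_norm M (T f) / L1_norm M f" by (simp add: L1_norm_scale c)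
  finally have "L1_norm M (T f) / L1_norm M f \<le> L1_opnorm M T"
    using L1_opnorm_upper[OF T L1_scale[OF f, of c]] pos by (simp add: L1_norm_scale c)
  then show ?thesis using pos by (simp add: pos_divide_le_eq)
qed

section \<open>Norm closures and closed algebras\<close>

text \<open>Trades the supremum for estimates at each \<open>f\<close>, which can be added and
  composed directly. The direction back to the supremum works with half of \<epsilon>, since a
  supremum may reach a bound that all values stay below.\<close>

lemma L1_op_closure_iff:
  assumes "A \<subseteq> L1_ops M"
  shows "T \<in> L1_op_closure M A \<longleftrightarrow> T \<in> L1_ops M \<and>
    (\<forall>\<epsilon>>0. \<exists>S\<in>A. \<forall>f\<in>L1 M. L1_norm M (\<lambda>x. T f x - S f x) \<le> \<epsilon> * L1_norm M f)"
    (is "_ \<longleftrightarrow> _ \<and> ?R")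
proof (cases "T \<in> L1_ops M")
  case T: True
  have "T \<in> L1_op_closure M A \<longleftrightarrow> (\<forall>\<epsilon>>0. \<exists>S\<in>A. L1_opnorm M (op_diff T S) < \<epsilon>)" (is "_ \<longleftrightarrow> ?L")
    using T by (simp add: L1_op_closure_def)
  also have "\<dots> \<longleftrightarrow> ?R"
  proof
    assume L: ?L
    show ?R
    proof (intro allI impI)
      fix e :: real assume "e > 0"
      then obtain S where S: "S \<in> A" "L1_opnorm M (op_diff T S) < e" using L by blast
      have "L1_norm M (\<lambda>x. T f x - S f x) \<le> e * L1_norm M f" if f: "f \<in> L1 M" for f
      proof -
        have "L1_norm M (op_diff T S f) \<le> L1_opnorm M (op_diff T S) * L1_norm M f"
          using S T assms f by (intro L1_norm_le_opnorm L1_ops_op_diff) auto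
        also have "\<dots> \<le> e * L1_norm M f" using S by (intro mult_right_mono L1_norm_nonneg) auto
        finally show ?thesis by (simp add: op_diff_def)
      qed
      with S show "\<exists>S\<in>A. \<forall>f\<in>L1 M. L1_norm M (\<lambda>x. T f x - S f x) \<le> e * L1_norm M f" by blast
    qed
  next
    assume R: ?R
    show ?L
    proof (intro allI impI)
      fix e :: real assume e: "e > 0"
      then obtain S where S: "S \<in> A" "\<forall>f\<in>L1 M. L1_norm M (\<lambda>x. T f x - S f x) \<le> (e/2) * L1_norm M f"
        using R by (meson half_gt_zero)
      have "L1_opnorm M (op_diff T S) \<le> e/2"
      proof (rule L1_opnorm_le)
        fix f assume f: "f \<in> L1 M" "L1_norm M f \<le> 1"
        have "L1_norm M (op_diff T S f) \<le> (e/2) * L1_norm M f" using S f by (simp add: op_diff_def)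
        also have "\<dots> \<le> e/2" using mult_left_mono[OF f(2), of "e/2"] e by simp
        finally show "L1_norm M (op_diff T S f) \<le> e/2" .
      qed
      with S e show "\<exists>S\<in>A. L1_opnorm M (op_diff T S) < e" by force
    qed
  qed
  finally show ?thesis using T by simp
qed (simp add: L1_op_closure_def)

lemma L1_norm_diff_triangle:
  assumes "f \<in> L1 M" "g \<in> L1 M" "h \<in> L1 M"
  shows "L1_norm M (\<lambda>x. f x - h x) \<le> L1_norm M (\<lambda>x. f x - g x) + L1_norm M (\<lambda>x. g x - h x)"
  using L1_norm_add[OF L1_diff[OF assms(1,2)] L1_diff[OF assms(2,3)]] by simp

lemma L1_op_closure_subset:
  assumes "A \<subseteq> L1_ops M"
  shows "A \<subseteq> L1_op_closure M A"
proof
  fix T assume "T \<in> A"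
  then show "T \<in> L1_op_closure M A"
    using assms by (subst L1_op_closure_iff[OF assms]) (auto intro!: bexI[of _ T] simp: L1_norm_zero L1_norm_nonneg)
qed

lemma L1_op_closure_idem:
  assumes A: "A \<subseteq> L1_ops M"
  shows "L1_op_closure M (L1_op_closure M A) \<subseteq> L1_op_closure M A"
proof
  have B: "L1_op_closure M A \<subseteq> L1_ops M" by (auto simp: L1_op_closure_def)
  fix T assume T: "T \<in> L1_op_closure M (L1_op_closure M A)"
  show "T \<in> L1_op_closure M A"
    unfolding L1_op_closure_iff[OF A]
  proof (intro conjI allI impI)
    show T': "T \<in> L1_ops M" using T by (simp add: L1_op_closure_def)
    fix e :: real assume "e > 0"
    then have e: "e / 2 > 0" by simp
    obtain S where S: "S \<in> L1_op_closure M A"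
      "\<And>f. f \<in> L1 M \<Longrightarrow> L1_norm M (\<lambda>x. T f x - S f x) \<le> e/2 * L1_norm M f"
      using T e unfolding L1_op_closure_iff[OF B] by blast
    obtain R where R: "R \<in> A"
      "\<And>f. f \<in> L1 M \<Longrightarrow> L1_norm M (\<lambda>x. S f x - R f x) \<le> e/2 * L1_norm M f"
      using S(1) e unfolding L1_op_closure_iff[OF A] by blast
    have "L1_norm M (\<lambda>x. T f x - R f x) \<le> e * L1_norm M f" if f: "f \<in> L1 M" for f
    proof -
      have "T f \<in> L1 M" "S f \<in> L1 M" "R f \<in> L1 M"
        using T' S(1) R(1) A B f L1_ops_L1[of _ M f] by blast+
      from L1_norm_diff_triangle[OF this] S(2)[OF f] R(2)[OF f] show ?thesis by simp
    qed
    with R show "\<exists>S\<in>A. \<forall>f\<in>L1 M. L1_norm M (\<lambda>x. T f x - S f x) \<le> e * L1_norm M f" by blast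
  qed
qed

text \<open>The operations are continuous for the operator norm, so they carry approximants to
  approximants. For products the error is split as
  \<open>S T - V U = (S - V) T + V (T - U)\<close>.\<close>

lemma L1_operator_algebra_closure:
  assumes A: "A \<subseteq> L1_ops M" "A \<noteq> {}"
    and add: "\<And>S T. S \<in> A \<Longrightarrow> T \<in> A \<Longrightarrow> op_add S T \<in> A"
    and scale: "\<And>c T. T \<in> A \<Longrightarrow> op_scale c T \<in> A"
    and comp: "\<And>S T. S \<in> A \<Longrightarrow> T \<in> A \<Longrightarrow> S \<circ> T \<in> A"
  shows "L1_operator_algebra M (L1_op_closure M A)"
  unfolding L1_operator_algebra_def
proof (intro conjI ballI allI)
  let ?B = "L1_op_closure M A"
  note iff = L1_op_closure_iff[OF A(1)]
  show B: "?B \<subseteq> L1_ops M" by (auto simp: L1_op_closure_def)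
  show "?B \<noteq> {}" using A L1_op_closure_subset[OF A(1)] by blast
  show "L1_op_closure M ?B \<subseteq> ?B" by (rule L1_op_closure_idem[OF A(1)])
  have L1': "T f \<in> L1 M" if "T \<in> A \<or> T \<in> ?B" "f \<in> L1 M" for T f
    using that A B L1_ops_L1[of T M f] by blast
  have approx: "\<exists>S'\<in>A. \<forall>f\<in>L1 M. L1_norm M (\<lambda>x. S f x - S' f x) \<le> e * L1_norm M f"
    if "S \<in> ?B" "e > 0" for S and e :: real
    using that unfolding iff by blast
  fix T assume T: "T \<in> ?B"
  then have T': "T \<in> L1_ops M" using B by blast
  show "op_scale c T \<in> ?B" for c
    unfolding iff
  proof (intro conjI allI impI)
    show "op_scale c T \<in> L1_ops M" using T' by (rule L1_ops_op_scale)
    fix e :: real assume e: "e > 0"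
    \<comment> \<open>Adding \<open>1\<close> keeps the denominator positive when
      \<open>c = 0\<close>.\<close>
    define e' where "e' = e / (norm c + 1)"
    have c1: "0 < norm c + 1" using norm_ge_zero[of c] by linarith
    then have e': "e' > 0" "norm c * e' \<le> e"
      using e by (auto simp: e'_def field_simps)
    obtain U where U: "U \<in> A" "\<And>f. f \<in> L1 M \<Longrightarrow> L1_norm M (\<lambda>x. T f x - U f x) \<le> e' * L1_norm M f"
      using approx[OF T e'(1)] by blast
    have "L1_norm M (\<lambda>x. op_scale c T f x - op_scale c U f x) \<le> e * L1_norm M f" if f: "f \<in> L1 M" for f
    proof -
      have "L1_norm M (\<lambda>x. op_scale c T f x - op_scale c U f x) = norm c * L1_norm M (\<lambda>x. T f x - U f x)"
        by (simp add: op_scale_def flip: right_diff_distrib L1_norm_scale)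
      also have "\<dots> \<le> norm c * (e' * L1_norm M f)" by (intro mult_left_mono U(2) f) auto
      also have "\<dots> \<le> e * L1_norm M f"
        using mult_right_mono[OF e'(2) L1_norm_nonneg[of M f]] by (simp add: mult.assoc)
      finally show ?thesis .
    qed
    with scale[OF U(1)] show "\<exists>S\<in>A. \<forall>f\<in>L1 M. L1_norm M (\<lambda>x. op_scale c T f x - S f x) \<le> e * L1_norm M f"
      by blast
  qed
  fix S assume S: "S \<in> ?B"
  then have S': "S \<in> L1_ops M" using B by blast
  show "op_add S T \<in> ?B"
    unfolding iff
  proof (intro conjI allI impI)
    show "op_add S T \<in> L1_ops M" using S' T' by (rule L1_ops_op_add)
    fix e :: real assume "e > 0"
    then have e: "e / 2 > 0" by simp
    obtain U where U: "U \<in> A" "\<And>f. f \<in> L1 M \<Longrightarrow> L1_norm M (\<lambda>x. T f x - U f x) \<le> e/2 * L1_norm M f"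
      using approx[OF T e] by blast
    obtain V where V: "V \<in> A" "\<And>f. f \<in> L1 M \<Longrightarrow> L1_norm M (\<lambda>x. S f x - V f x) \<le> e/2 * L1_norm M f"
      using approx[OF S e] by blast
    have "L1_norm M (\<lambda>x. op_add S T f x - op_add V U f x) \<le> e * L1_norm M f" if f: "f \<in> L1 M" for f
    proof -
      have mem: "S f \<in> L1 M" "V f \<in> L1 M" "T f \<in> L1 M" "U f \<in> L1 M"
        using S T U(1) V(1) f L1'[where f = f] by blast+
      have "L1_norm M (\<lambda>x. (S f x - V f x) + (T f x - U f x))
          \<le> L1_norm M (\<lambda>x. S f x - V f x) + L1_norm M (\<lambda>x. T f x - U f x)"
        by (intro L1_norm_add L1_diff mem)
      moreover have "(\<lambda>x. op_add S T f x - op_add V U f x) = (\<lambda>x. (S f x - V f x) + (T f x - U f x))"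
        by (auto simp: op_add_def)
      ultimately show ?thesis using U(2)[OF f] V(2)[OF f] by simp
    qed
    with add[OF V(1) U(1)] show "\<exists>S'\<in>A. \<forall>f\<in>L1 M. L1_norm M (\<lambda>x. op_add S T f x - S' f x) \<le> e * L1_norm M f"
      by blast
  qed
  show "S \<circ> T \<in> ?B"
    unfolding iff
  proof (intro conjI allI impI)
    show "S \<circ> T \<in> L1_ops M" using S' T' by (rule L1_ops_comp)
    fix e :: real assume e: "e > 0"
    obtain L where L: "L \<ge> 0" "\<And>f. f \<in> L1 M \<Longrightarrow> L1_norm M (T f) \<le> L * L1_norm M f"
      using L1_ops_bound[OF T'] by metis
    \<comment> \<open>The order of choice matters: \<open>e1\<close> depends on the bound
      \<open>L\<close> of \<open>T\<close>, the bound \<open>K\<close> of \<open>V\<close> exists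
      only once \<open>V\<close> is chosen, and \<open>U\<close> is then chosen with an error
      \<open>e2\<close> that depends on \<open>K\<close>.\<close>
    define e1 where "e1 = e / (2 * (L + 1))"
    have e1: "e1 > 0" "e1 * L \<le> e / 2" using e L(1) by (auto simp: e1_def field_simps)
    obtain V where V: "V \<in> A" "\<And>f. f \<in> L1 M \<Longrightarrow> L1_norm M (\<lambda>x. S f x - V f x) \<le> e1 * L1_norm M f"
      using approx[OF S e1(1)] by blast
    then have V': "V \<in> L1_ops M" using A by blast
    obtain K where K: "K \<ge> 0" "\<And>f. f \<in> L1 M \<Longrightarrow> L1_norm M (V f) \<le> K * L1_norm M f"
      using L1_ops_bound[OF V'] by metis
    define e2 where "e2 = e / (2 * (K + 1))"
    have e2: "e2 > 0" "K * e2 \<le> e / 2" using e K(1) by (auto simp: e2_def field_simps)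
    obtain U where U: "U \<in> A" "\<And>f. f \<in> L1 M \<Longrightarrow> L1_norm M (\<lambda>x. T f x - U f x) \<le> e2 * L1_norm M f"
      using approx[OF T e2(1)] by blast
    have "L1_norm M (\<lambda>x. (S \<circ> T) f x - (V \<circ> U) f x) \<le> e * L1_norm M f" if f: "f \<in> L1 M" for f
    proof -
      have Tf: "T f \<in> L1 M" "U f \<in> L1 M" using T U(1) f L1'[where f = f] by blast+
      have D: "(\<lambda>x. T f x - U f x) \<in> L1 M" using Tf by (rule L1_diff)
      \<comment> \<open>Subtraction enters through additivity, by writing \<open>T f\<close> as
        \<open>U f + (T f - U f)\<close>.\<close>
      have "AE x in M. V (\<lambda>x. U f x + (T f x - U f x)) x = V (U f) x + V (\<lambda>x. T f x - U f x) x"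
        by (rule L1_ops_add[OF V' Tf(2) D])
      then have eq: "AE x in M. V (T f) x - V (U f) x = V (\<lambda>x. T f x - U f x) x"
        by (auto simp: algebra_simps)
      have "L1_norm M (\<lambda>x. S (T f) x - V (T f) x) \<le> e1 * L1_norm M (T f)" using V(2) Tf by blast
      also have "\<dots> \<le> e1 * (L * L1_norm M f)" using L(2) f e1(1) by (intro mult_left_mono) auto
      also have "\<dots> \<le> e/2 * L1_norm M f"
        using mult_right_mono[OF e1(2) L1_norm_nonneg[of M f]] by (simp add: mult.assoc)
      finally have 1: "L1_norm M (\<lambda>x. S (T f) x - V (T f) x) \<le> e/2 * L1_norm M f" .
      have "L1_norm M (\<lambda>x. V (T f) x - V (U f) x) = L1_norm M (V (\<lambda>x. T f x - U f x))"
        by (intro L1_norm_cong_AE eq L1_diff L1_ops_L1[OF V'] Tf D)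
      also have "\<dots> \<le> K * L1_norm M (\<lambda>x. T f x - U f x)" using K(2) D by blast
      also have "\<dots> \<le> K * (e2 * L1_norm M f)" using U(2) f K(1) by (intro mult_left_mono) auto
      also have "\<dots> \<le> e/2 * L1_norm M f"
        using mult_right_mono[OF e2(2) L1_norm_nonneg[of M f]] by (simp add: mult.assoc)
      finally have 2: "L1_norm M (\<lambda>x. V (T f) x - V (U f) x) \<le> e/2 * L1_norm M f" .
      have "S (T f) \<in> L1 M" "V (T f) \<in> L1 M" "V (U f) \<in> L1 M"
        using L1_ops_L1[OF S'] L1_ops_L1[OF V'] Tf by blast+
      from L1_norm_diff_triangle[OF this] 1 2 show ?thesis by simp
    qed
    with comp[OF V(1) U(1)] show "\<exists>S'\<in>A. \<forall>f\<in>L1 M. L1_norm M (\<lambda>x. (S \<circ> T) f x - S' f x) \<le> e * L1_norm M f"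
      by blast
  qed
qed

section \<open>Matrix norms from below\<close>

text \<open>The vector with \<open>f\<close> in position \<open>j\<close> and zero elsewhere is an
  admissible test vector, and the matrix sends it to its column \<open>j\<close> applied to
  \<open>f\<close>. With \<open>f = delta y\<close> this is the lower half of the description of
  matrix norms by columns; \<open>L1_matrix_norm_le_of_columns\<close> is the upper half.\<close>

lemma sum_L1_norm_le_matrix_norm:
  assumes a: "\<And>i j. i < n \<Longrightarrow> j < n \<Longrightarrow> a i j \<in> L1_ops M"
    and j: "j < n" and f: "f \<in> L1 M" "L1_norm M f \<le> 1"
  shows "(\<Sum>i<n. L1_norm M (a i j f)) \<le> L1_matrix_norm M n a"
proof -
  define v where "v = (\<lambda>k. if k = j then f else (\<lambda>x. 0))"
  have v: "v k \<in> L1 M" for k using f by (simp add: v_def L1_zero)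
  have "L1_sum_norm M n v = (\<Sum>k<n. if k = j then L1_norm M f else 0)"
    unfolding L1_sum_norm_def by (intro sum.cong) (auto simp: v_def L1_norm_zero)
  then have v1: "L1_sum_norm M n v \<le> 1" using f j by simp
  have ap: "matrix_apply n a w i \<in> L1 M" if "i < n" "\<And>k. k < n \<Longrightarrow> w k \<in> L1 M" for w i
    unfolding matrix_apply_def by (intro L1_sum L1_ops_L1[OF a]) (use that in auto)
  have "L1_norm M (a i j f) = L1_norm M (matrix_apply n a v i)" if i: "i < n" for i
  proof (intro L1_norm_cong_AE ap i v L1_ops_L1[OF a[OF i j]] f)
    \<comment> \<open>A representative may send the zero function to a nonzero null function, so the
      other entries of the row vanish only almost everywhere; finitely many null sets are
      joined.\<close>
    have "AE x in M. \<forall>k\<in>{..<n}. k \<noteq> j \<longrightarrow> a i k (\<lambda>x. 0) x = 0"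
      using a i by (intro AE_finite_allI) (auto intro: L1_ops_zero)
    then show "AE x in M. a i j f x = matrix_apply n a v i x"
    proof eventually_elim
      case (elim x)
      have "matrix_apply n a v i x = (\<Sum>k<n. if k = j then a i j f x else 0)"
        unfolding matrix_apply_def using elim by (intro sum.cong) (auto simp: v_def)
      then show ?case using j by simp
    qed
  qed
  then have "(\<Sum>i<n. L1_norm M (a i j f)) = L1_sum_norm M n (matrix_apply n a v)"
    by (simp add: L1_sum_norm_def)
  also have "\<dots> \<le> L1_matrix_norm M n a"
    unfolding L1_matrix_norm_def
  proof (rule cSup_upper)
    \<comment> \<open>A real supremum dominates the members of its set only if the set is bounded
      above. The total of the operator norms of all entries is a crude bound that suffices.\<close>
    show "bdd_above {L1_sum_norm M n (matrix_apply n a v) |v. (\<forall>j<n. v j \<in> L1 M) \<and> L1_sum_norm M n v \<le> 1}"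
    proof (rule bdd_aboveI[where M = "\<Sum>i<n. \<Sum>k<n. L1_opnorm M (a i k)"], clarify)
      fix w assume w: "\<forall>j<n. w j \<in> L1 M" "L1_sum_norm M n w \<le> 1"
      have w1: "L1_norm M (w k) \<le> 1" if "k < n" for k
      proof -
        have "L1_norm M (w k) \<le> (\<Sum>k<n. L1_norm M (w k))"
          using that by (intro member_le_sum) (auto simp: L1_norm_nonneg)
        then show ?thesis using w by (simp add: L1_sum_norm_def)
      qed
      have "L1_sum_norm M n (matrix_apply n a w) \<le> (\<Sum>i<n. \<Sum>k<n. L1_norm M (a i k (w k)))"
        unfolding L1_sum_norm_def matrix_apply_def
        by (intro sum_mono L1_norm_sum L1_ops_L1[OF a]) (use w in auto)
      also have "\<dots> \<le> (\<Sum>i<n. \<Sum>k<n. L1_opnorm M (a i k))"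
      proof (intro sum_mono)
        fix i k assume "i \<in> {..<n}" "k \<in> {..<n}"
        then have "L1_norm M (a i k (w k)) \<le> L1_opnorm M (a i k) * L1_norm M (w k)"
          using a w by (intro L1_norm_le_opnorm) auto
        also have "\<dots> \<le> L1_opnorm M (a i k)"
          using mult_left_mono[OF w1[of k] L1_opnorm_nonneg[OF a[of i k]]]
            \<open>i \<in> {..<n}\<close> \<open>k \<in> {..<n}\<close> by simp
        finally show "L1_norm M (a i k (w k)) \<le> L1_opnorm M (a i k)" .
      qed
      finally show "L1_sum_norm M n (matrix_apply n a w) \<le> (\<Sum>i<n. \<Sum>k<n. L1_opnorm M (a i k))" .
    qed
  qed (use v v1 in blast)
  finally show ?thesis .
qed

section \<open>Operators on \<open>\<ell>\<^sup>1\<close>\<close>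

text \<open>For nonnegative terms, a common bound on the finite partial sums yields both summability
  and the bound on the total. Membership and norm estimate are thus obtained together, and later
  estimates deal with finite sums only.\<close>

lemma L1_count_space_le_iff:
  "f \<in> L1 (count_space X) \<and> L1_norm (count_space X) f \<le> C \<longleftrightarrow>
    (\<forall>F. finite F \<and> F \<subseteq> X \<longrightarrow> (\<Sum>x\<in>F. norm (f x)) \<le> C)" (is "?L \<longleftrightarrow> ?R")
proof -
  have eq: "f \<in> L1 (count_space X) \<longleftrightarrow> (\<lambda>x. norm (f x)) summable_on X"
    using abs_summable_equivalent[of f X] by (simp add: L1_def Infinite_Set_Sum.abs_summable_on_def)
  have nrm: "L1_norm (count_space X) f = infsum (\<lambda>x. norm (f x)) X" if "f \<in> L1 (count_space X)"
    using infsetsum_infsum[of "\<lambda>x. norm (f x)" X] that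
    by (simp add: L1_def L1_norm_def infsetsum_def Infinite_Set_Sum.abs_summable_on_def)
  show ?thesis
  proof
    assume L: ?L
    show ?R
    proof clarify
      fix F assume "finite F" "F \<subseteq> X"
      then have "(\<Sum>x\<in>F. norm (f x)) \<le> infsum (\<lambda>x. norm (f x)) X"
        using L eq by (intro finite_sum_le_infsum) auto
      then show "(\<Sum>x\<in>F. norm (f x)) \<le> C" using L nrm by simp
    qed
  next
    assume R: ?R
    then have s: "(\<lambda>x. norm (f x)) summable_on X"
      by (intro nonneg_bdd_above_summable_on bdd_aboveI[where M = C]) auto
    moreover have "infsum (\<lambda>x. norm (f x)) X \<le> C"
      using s R by (intro infsum_le_finite_sums) auto
    ultimately show ?L using eq nrm by simp
  qed
qed

lemma sum_norm_le_L1_norm: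
  "f \<in> L1 (count_space X) \<Longrightarrow> finite F \<Longrightarrow> F \<subseteq> X \<Longrightarrow> (\<Sum>x\<in>F. norm (f x)) \<le> L1_norm (count_space X) f"
  using L1_count_space_le_iff[of f X "L1_norm (count_space X) f"] by blast

lemma L1_count_spaceI:
  assumes "\<And>F. finite F \<Longrightarrow> F \<subseteq> X \<Longrightarrow> (\<Sum>x\<in>F. norm (f x)) \<le> C"
  shows "f \<in> L1 (count_space X)" "L1_norm (count_space X) f \<le> C"
  using L1_count_space_le_iff[of f X C] assms by blast+

lemma L1_norm_count_space_cong:
  "(\<And>x. x \<in> X \<Longrightarrow> f x = g x) \<Longrightarrow> L1_norm (count_space X) f = L1_norm (count_space X) g"
  unfolding L1_norm_def by (intro Bochner_Integration.integral_cong) auto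

text \<open>The norm is bounded by \<open>1\<close> instead of being equal to it, because
  \<open>y\<close> may lie outside \<open>X\<close>; then \<open>delta y\<close> vanishes on
  \<open>X\<close>.\<close>

lemma
  shows delta_in_L1: "delta y \<in> L1 (count_space X)"
    and L1_norm_delta: "L1_norm (count_space X) (delta y) \<le> 1"
proof -
  have "(\<Sum>x\<in>F. norm (delta y x)) \<le> 1" if "finite F" for F
  proof -
    have "(\<Sum>x\<in>F. norm (delta y x)) = (\<Sum>x\<in>F. if x = y then 1 else 0)"
      by (intro sum.cong) (auto simp: delta_def)
    with that show ?thesis by simp
  qed
  then show "delta y \<in> L1 (count_space X)" "L1_norm (count_space X) (delta y) \<le> 1"
    by (auto intro: L1_count_spaceI)
qed

lemma L1_norm_column_le_opnorm:
  assumes "a \<in> L1_ops (count_space X)"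
  shows "L1_norm (count_space X) (a (delta y)) \<le> L1_opnorm (count_space X) a"
  using order_trans[OF L1_norm_le_opnorm[OF assms delta_in_L1, of y]
      mult_left_mono[OF L1_norm_delta[of X y] L1_opnorm_nonneg[OF assms]]] by simp

section \<open>Norms controlled by columns\<close>

text \<open>The counting measure has no nonempty null sets, so linearity almost everywhere becomes
  equality at every point of \<open>X\<close>.\<close>

lemma L1_ops_finite_support:
  assumes T: "T \<in> L1_ops (count_space X)" and F: "finite F" and x: "x \<in> X"
  shows "T (\<lambda>y. \<Sum>z\<in>F. c z * delta z y) x = (\<Sum>z\<in>F. c z * T (delta z) x)"
  using F
proof (induction F rule: finite_induct)
  case empty
  then show ?case using L1_ops_zero[OF T] x by (simp add: AE_count_space)
next
  case (insert z F)
  have "T (\<lambda>y. c z * delta z y + (\<Sum>z\<in>F. c z * delta z y)) x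
      = T (\<lambda>y. c z * delta z y) x + T (\<lambda>y. \<Sum>z\<in>F. c z * delta z y) x"
    using L1_ops_add[OF T L1_scale[OF delta_in_L1, of "c z"] L1_sum, of F "\<lambda>z y. c z * delta z y" z] x
    by (auto simp: AE_count_space L1_scale delta_in_L1)
  moreover have "T (\<lambda>y. c z * delta z y) x = c z * T (delta z) x"
    using L1_ops_scale[OF T delta_in_L1, of "c z" z] x by (simp add: AE_count_space)
  ultimately show ?case using insert by simp
qed

lemma finite_restrict_eq_sum_delta:
  "finite F \<Longrightarrow> (if y \<in> F then f y else 0) = (\<Sum>z\<in>F. f z * delta z y)"
  by (simp add: delta_def if_distrib[of "(*) _"] cong: if_cong)

text \<open>The norm is the least bound of the finite partial sums, so the sum over some finite
  \<open>F\<close> exceeds the norm minus \<open>e\<close>; every finite sum off \<open>F\<close> is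
  then at most \<open>e\<close>.\<close>

lemma L1_count_space_tail:
  assumes f: "f \<in> L1 (count_space X)" and e: "e > 0"
  obtains F where "finite F" "F \<subseteq> X" "(\<lambda>y. if y \<in> F then 0 else f y) \<in> L1 (count_space X)"
    "L1_norm (count_space X) (\<lambda>y. if y \<in> F then 0 else f y) \<le> e"
proof -
  let ?N = "L1_norm (count_space X) f"
  have "\<not> (\<forall>F. finite F \<and> F \<subseteq> X \<longrightarrow> (\<Sum>x\<in>F. norm (f x)) \<le> ?N - e)"
    using e by (subst L1_count_space_le_iff[symmetric]) simp
  then obtain F where F: "finite F" "F \<subseteq> X" "(\<Sum>x\<in>F. norm (f x)) > ?N - e"
    by (auto simp: not_le)
  have "(\<Sum>x\<in>G. norm (if x \<in> F then 0 else f x)) \<le> e" if G: "finite G" "G \<subseteq> X" for G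
  proof -
    have "(\<Sum>x\<in>G. norm (if x \<in> F then 0 else f x)) = (\<Sum>x\<in>G - F. norm (f x))"
      using G by (intro sum.mono_neutral_cong_right) auto
    moreover have "(\<Sum>x\<in>G - F. norm (f x)) + (\<Sum>x\<in>F. norm (f x)) = (\<Sum>x\<in>G \<union> F. norm (f x))"
      using G F by (subst sum.union_disjoint[symmetric]) (auto intro: sum.cong)
    moreover have "(\<Sum>x\<in>G \<union> F. norm (f x)) \<le> ?N"
      using G F f by (intro sum_norm_le_L1_norm) auto
    ultimately show ?thesis using F(3) by simp
  qed
  from that[OF F(1,2) L1_count_spaceI[OF this]] show thesis by blast
qed

text \<open>The finite family stands for a column of a matrix of operators.\<close>

lemma sum_L1_norm_le_of_columns:
  assumes T: "\<And>i. i \<in> J \<Longrightarrow> T i \<in> L1_ops (count_space X)" and J: "finite J"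
    and C: "C \<ge> 0" "\<And>y. y \<in> X \<Longrightarrow> (\<Sum>i\<in>J. L1_norm (count_space X) (T i (delta y))) \<le> C"
    and f: "f \<in> L1 (count_space X)"
  shows "(\<Sum>i\<in>J. L1_norm (count_space X) (T i f)) \<le> C * L1_norm (count_space X) f"
proof -
  let ?M = "count_space X"
  define K where "K i = L1_opnorm ?M (T i)" for i
  have K: "\<And>i. i \<in> J \<Longrightarrow> 0 \<le> K i"
    "\<And>i g. i \<in> J \<Longrightarrow> g \<in> L1 ?M \<Longrightarrow> L1_norm ?M (T i g) \<le> K i * L1_norm ?M g"
    using T by (auto simp: K_def L1_opnorm_nonneg L1_norm_le_opnorm)
  define k where "k = (\<Sum>i\<in>J. K i)"
  have k: "k \<ge> 0" unfolding k_def using K(1) by (rule sum_nonneg)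
  show ?thesis
  proof (rule field_le_epsilon)
    fix e :: real assume e: "e > 0"
    \<comment> \<open>The function \<open>f\<close> is cut into a finitely supported
      \<open>g\<close>, where linearity and the column bound work, and a tail of norm at most
      \<open>e'\<close>, where only the operator norms are known. Their total \<open>k\<close>
      determines \<open>e'\<close>; the \<open>1\<close> covers \<open>k = 0\<close>.\<close>
    define e' where "e' = e / (k + 1)"
    have e': "e' > 0" "k * e' \<le> e" using e k by (auto simp: e'_def field_simps)
    obtain F where F: "finite F" "F \<subseteq> X" and h: "(\<lambda>y. if y \<in> F then 0 else f y) \<in> L1 ?M"
      "L1_norm ?M (\<lambda>y. if y \<in> F then 0 else f y) \<le> e'" (is "L1_norm _ ?h \<le> _")
      by (rule L1_count_space_tail[OF f e'(1)])
    define g where "g = (\<lambda>y. \<Sum>z\<in>F. f z * delta z y)"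
    have g: "g \<in> L1 ?M" unfolding g_def by (intro L1_sum L1_scale delta_in_L1)
    have fgh: "f = (\<lambda>y. g y + ?h y)"
      by (auto simp: g_def finite_restrict_eq_sum_delta[OF F(1), symmetric])
    have 1: "L1_norm ?M (T i f) \<le> L1_norm ?M (T i g) + L1_norm ?M (T i ?h)" if i: "i \<in> J" for i
    proof -
      have "L1_norm ?M (T i f) = L1_norm ?M (\<lambda>x. T i g x + T i ?h x)"
        by (subst fgh, intro L1_norm_cong_AE L1_ops_add[OF T[OF i] g h(1)])
           (intro L1_add L1_ops_L1[OF T[OF i]] g h(1))+
      also have "\<dots> \<le> L1_norm ?M (T i g) + L1_norm ?M (T i ?h)"
        by (intro L1_norm_add L1_ops_L1[OF T[OF i]] g h(1))
      finally show ?thesis .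
    qed
    have 2: "L1_norm ?M (T i g) \<le> (\<Sum>z\<in>F. norm (f z) * L1_norm ?M (T i (delta z)))" if i: "i \<in> J" for i
    proof -
      have "L1_norm ?M (T i g) = L1_norm ?M (\<lambda>x. \<Sum>z\<in>F. f z * T i (delta z) x)"
        unfolding g_def by (intro L1_norm_count_space_cong L1_ops_finite_support[OF T[OF i] F(1)])
      also have "\<dots> \<le> (\<Sum>z\<in>F. L1_norm ?M (\<lambda>x. f z * T i (delta z) x))"
        by (intro L1_norm_sum L1_scale L1_ops_L1[OF T[OF i]] delta_in_L1)
      finally show ?thesis by (simp add: L1_norm_scale)
    qed
    have "(\<Sum>i\<in>J. L1_norm ?M (T i f)) \<le> (\<Sum>i\<in>J. L1_norm ?M (T i g) + L1_norm ?M (T i ?h))"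
      using 1 by (rule sum_mono)
    also have "\<dots> \<le> (\<Sum>i\<in>J. (\<Sum>z\<in>F. norm (f z) * L1_norm ?M (T i (delta z))) + K i * e')"
    proof (intro sum_mono add_mono 2)
      fix i assume i: "i \<in> J"
      show "L1_norm ?M (T i ?h) \<le> K i * e'"
        using K(2)[OF i h(1)] mult_left_mono[OF h(2) K(1)[OF i]] by linarith
    qed
    \<comment> \<open>The bound \<open>C\<close> concerns the sum over \<open>J\<close> at one fixed
      point, so the sum over \<open>J\<close> has to become the inner one.\<close>
    also have "\<dots> = (\<Sum>z\<in>F. norm (f z) * (\<Sum>i\<in>J. L1_norm ?M (T i (delta z)))) + k * e'"
      by (simp add: sum.distrib sum_distrib_left sum_distrib_right k_def sum.swap[of _ J F])
    also have "\<dots> \<le> (\<Sum>z\<in>F. norm (f z) * C) + e"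
      using F C by (intro add_mono sum_mono mult_left_mono e') auto
    also have "(\<Sum>z\<in>F. norm (f z) * C) = C * (\<Sum>z\<in>F. norm (f z))"
      by (simp add: sum_distrib_left mult.commute)
    also have "\<dots> \<le> C * L1_norm ?M f"
      by (intro mult_left_mono sum_norm_le_L1_norm f F C)
    finally show "(\<Sum>i\<in>J. L1_norm ?M (T i f)) \<le> C * L1_norm ?M f + e" by simp
  qed
qed

text \<open>After the triangle inequality and an exchange of sums, column \<open>j\<close> of the
  matrix acts on \<open>v j\<close> alone. Each column is a finite family of operators, so
  \<open>sum_L1_norm_le_of_columns\<close> applies to it.\<close>

lemma L1_matrix_norm_le_of_columns:
  assumes a: "\<And>i j. i < n \<Longrightarrow> j < n \<Longrightarrow> a i j \<in> L1_ops (count_space X)"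
    and C: "C \<ge> 0"
      "\<And>j y. j < n \<Longrightarrow> y \<in> X \<Longrightarrow> (\<Sum>i<n. L1_norm (count_space X) (a i j (delta y))) \<le> C"
  shows "L1_matrix_norm (count_space X) n a \<le> C"
  unfolding L1_matrix_norm_def
proof (rule cSup_least)
  let ?M = "count_space X"
  show "{L1_sum_norm ?M n (matrix_apply n a v) |v. (\<forall>j<n. v j \<in> L1 ?M) \<and> L1_sum_norm ?M n v \<le> 1} \<noteq> {}"
    by (auto intro!: exI[of _ "\<lambda>j x. 0"] simp: L1_sum_norm_def L1_norm_zero L1_zero)
  fix r assume "r \<in> {L1_sum_norm ?M n (matrix_apply n a v) |v. (\<forall>j<n. v j \<in> L1 ?M) \<and> L1_sum_norm ?M n v \<le> 1}"
  then obtain v where r: "r = L1_sum_norm ?M n (matrix_apply n a v)"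
    and v: "\<And>j. j < n \<Longrightarrow> v j \<in> L1 ?M" "L1_sum_norm ?M n v \<le> 1" by blast
  have "r \<le> (\<Sum>i<n. \<Sum>j<n. L1_norm ?M (a i j (v j)))"
    unfolding r L1_sum_norm_def matrix_apply_def
    by (intro sum_mono L1_norm_sum L1_ops_L1[OF a]) (use v in auto)
  also have "\<dots> = (\<Sum>j<n. \<Sum>i<n. L1_norm ?M (a i j (v j)))" by (rule sum.swap)
  also have "\<dots> \<le> (\<Sum>j<n. C * L1_norm ?M (v j))"
    using a C v by (intro sum_mono sum_L1_norm_le_of_columns) auto
  also have "\<dots> = C * L1_sum_norm ?M n v" by (simp add: L1_sum_norm_def sum_distrib_left)
  also have "\<dots> \<le> C" using mult_left_mono[OF v(2) C(1)] by simp
  finally show "r \<le> C" .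
qed

lemma L1_opnorm_le_of_columns:
  assumes "T \<in> L1_ops (count_space X)" and C: "C \<ge> 0"
    "\<And>y. y \<in> X \<Longrightarrow> L1_norm (count_space X) (T (delta y)) \<le> C"
  shows "L1_opnorm (count_space X) T \<le> C"
proof (rule L1_opnorm_le)
  fix f assume f: "f \<in> L1 (count_space X)" "L1_norm (count_space X) f \<le> 1"
  have "L1_norm (count_space X) (T f) \<le> C * L1_norm (count_space X) f"
    using sum_L1_norm_le_of_columns[of "{()}" "\<lambda>_. T" X C f] assms f by simp
  also have "\<dots> \<le> C" using mult_left_mono[OF f(2) C(1)] by simp
  finally show "L1_norm (count_space X) (T f) \<le> C" .
qed

text \<open>In the last assumption the first disjunct allows for vanishing columns, also when \<open>X\<close> is empty.\<close>

lemma complete_contraction_1_of_columns: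
  fixes Y :: "'b set"
  assumes V: "V \<subseteq> L1_ops (count_space X)" and W: "W \<subseteq> L1_ops (count_space Y)"
    and maps: "\<And>a. a \<in> V \<Longrightarrow> \<phi> a \<in> W"
    and add: "\<And>a b. a \<in> V \<Longrightarrow> b \<in> V \<Longrightarrow> \<phi> (op_add a b) = op_add (\<phi> a) (\<phi> b)"
    and scale: "\<And>c a. a \<in> V \<Longrightarrow> \<phi> (op_scale c a) = op_scale c (\<phi> a)"
    and cols: "\<And>y. y \<in> Y \<Longrightarrow> (\<forall>a\<in>V. L1_norm (count_space Y) (\<phi> a (delta y)) \<le> 0) \<or>
      (\<exists>x\<in>X. \<forall>a\<in>V. L1_norm (count_space Y) (\<phi> a (delta y)) \<le> L1_norm (count_space X) (a (delta x)))"
  shows "complete_contraction_1 (count_space X) V (count_space Y) W \<phi>"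
  unfolding complete_contraction_1_def
proof (intro conjI allI ballI impI)
  fix n and a :: "nat \<Rightarrow> nat \<Rightarrow> 'a fn_op"
  assume "\<forall>i<n. \<forall>j<n. a i j \<in> V"
  then have a: "\<And>i j. i < n \<Longrightarrow> j < n \<Longrightarrow> a i j \<in> V" by blast
  let ?C = "L1_matrix_norm (count_space X) n a"
  have col: "(\<Sum>i<n. L1_norm (count_space X) (a i j (delta x))) \<le> ?C" if "j < n" for j x
    using a V that by (intro sum_L1_norm_le_matrix_norm delta_in_L1 L1_norm_delta) auto
  \<comment> \<open>For \<open>n > 0\<close> any column sum lies between \<open>0\<close> and
    \<open>?C\<close>; \<open>undefined\<close> may serve as its index because \<open>col\<close>
    holds for every \<open>x\<close>. For \<open>n = 0\<close> the supremum is taken over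
    \<open>{0}\<close>.\<close>
  have C0: "0 \<le> ?C"
  proof (cases "n = 0")
    case True
    have "{L1_sum_norm (count_space X) n (matrix_apply n a v) |v.
        (\<forall>j<n. v j \<in> L1 (count_space X)) \<and> L1_sum_norm (count_space X) n v \<le> 1} = {0}"
      using True by (auto simp: L1_sum_norm_def)
    then show ?thesis by (simp add: L1_matrix_norm_def)
  next
    case False
    then show ?thesis
      using col[of 0 undefined] sum_nonneg[of "{..<n}" "\<lambda>i. L1_norm (count_space X) (a i 0 (delta undefined))"]
      by (simp add: L1_norm_nonneg)
  qed
  show "L1_matrix_norm (count_space Y) n (\<lambda>i j. \<phi> (a i j)) \<le> ?C"
  proof (rule L1_matrix_norm_le_of_columns[OF _ C0])
    show "\<phi> (a i j) \<in> L1_ops (count_space Y)" if "i < n" "j < n" for i j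
      using that a maps W by blast
    fix j y assume j: "j < n" and y: "y \<in> Y"
    from cols[OF y] show "(\<Sum>i<n. L1_norm (count_space Y) (\<phi> (a i j) (delta y))) \<le> ?C"
    proof
      assume "\<forall>a\<in>V. L1_norm (count_space Y) (\<phi> a (delta y)) \<le> 0"
      then have "(\<Sum>i<n. L1_norm (count_space Y) (\<phi> (a i j) (delta y))) \<le> 0"
        using a j by (intro sum_nonpos) auto
      with C0 show ?thesis by simp
    next
      assume "\<exists>x\<in>X. \<forall>a\<in>V. L1_norm (count_space Y) (\<phi> a (delta y)) \<le> L1_norm (count_space X) (a (delta x))"
      then obtain x where x: "\<forall>a\<in>V. L1_norm (count_space Y) (\<phi> a (delta y)) \<le> L1_norm (count_space X) (a (delta x))"
        by blast
      \<comment> \<open>It matters that \<open>x\<close> does not depend on the operator: all rows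
        \<open>i\<close> are compared with the same column of the argument, the one at
        \<open>j\<close> and \<open>x\<close>, and its norm is at most \<open>?C\<close>.\<close>
      have "(\<Sum>i<n. L1_norm (count_space Y) (\<phi> (a i j) (delta y))) \<le> (\<Sum>i<n. L1_norm (count_space X) (a i j (delta x)))"
        using x a j by (intro sum_mono) auto
      with col[OF j] show ?thesis by (meson order_trans)
    qed
  qed
qed (use maps add scale in \<open>auto simp: L1_op_eq_def\<close>)

section \<open>Operators given by kernels\<close>

text \<open>Both maps of the factorization take values of this form. Row \<open>x\<close> is
  confined to \<open>B x\<close>, a finite set in both uses, so linearity holds exactly and only the
  norm has to be estimated.\<close>

definition kernel_op :: "('a \<Rightarrow> 'a set) \<Rightarrow> ('a \<Rightarrow> 'a \<Rightarrow> complex) \<Rightarrow> 'a fn_op" where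
  "kernel_op B k = (\<lambda>f x. \<Sum>y\<in>B x. k x y * f y)"

lemma kernel_op_add:
  "kernel_op B (\<lambda>x y. k x y + l x y) = op_add (kernel_op B k) (kernel_op B l)"
  by (simp add: kernel_op_def op_add_def sum.distrib algebra_simps)

lemma kernel_op_scale: "kernel_op B (\<lambda>x y. c * k x y) = op_scale c (kernel_op B k)"
  by (simp add: kernel_op_def op_scale_def sum_distrib_left algebra_simps)

lemma kernel_op_delta: "finite (B x) \<Longrightarrow> kernel_op B k (delta y) x = (if y \<in> B x then k x y else 0)"
  by (simp add: kernel_op_def delta_def if_distrib[of "(*) _"] cong: if_cong)

text \<open>Exchanging the two summations leaves the column sums of the kernel inside, and each of
  them is at most \<open>C\<close>.\<close>

lemma kernel_op_in_L1_ops: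
  assumes B: "\<And>x. x \<in> X \<Longrightarrow> finite (B x)" "\<And>x. x \<in> X \<Longrightarrow> B x \<subseteq> X"
    and C: "C \<ge> 0"
      "\<And>y F. y \<in> X \<Longrightarrow> finite F \<Longrightarrow> F \<subseteq> X \<Longrightarrow> (\<Sum>x | x \<in> F \<and> y \<in> B x. norm (k x y)) \<le> C"
  shows "kernel_op B k \<in> L1_ops (count_space X)"
proof -
  have *: "(\<Sum>x\<in>F. norm (kernel_op B k f x)) \<le> C * L1_norm (count_space X) f"
    if f: "f \<in> L1 (count_space X)" and F: "finite F" "F \<subseteq> X" for f F
  proof -
    \<comment> \<open>One finite set that contains \<open>B x\<close> for all rows \<open>x\<close>
      in \<open>F\<close> turns the dependent double sum into a sum over a rectangle, where the
      exchange is possible.\<close>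
    define G where "G = (\<Union>x\<in>F. B x)"
    have G: "finite G" "G \<subseteq> X" using B F by (auto simp: G_def)
    have "(\<Sum>x\<in>F. norm (kernel_op B k f x)) \<le> (\<Sum>x\<in>F. \<Sum>y\<in>B x. norm (k x y) * norm (f y))"
      unfolding kernel_op_def by (intro sum_mono sum_norm_le) (simp add: norm_mult)
    also have "\<dots> = (\<Sum>x\<in>F. \<Sum>y\<in>G. if y \<in> B x then norm (k x y) * norm (f y) else 0)"
    proof (rule sum.cong[OF refl])
      fix x assume "x \<in> F"
      then show "(\<Sum>y\<in>B x. norm (k x y) * norm (f y)) = (\<Sum>y\<in>G. if y \<in> B x then norm (k x y) * norm (f y) else 0)"
        using G by (intro sum.mono_neutral_cong_left) (auto simp: G_def)
    qed
    also have "\<dots> = (\<Sum>y\<in>G. \<Sum>x\<in>F. if y \<in> B x then norm (k x y) * norm (f y) else 0)" by (rule sum.swap)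
    also have "\<dots> = (\<Sum>y\<in>G. (\<Sum>x | x \<in> F \<and> y \<in> B x. norm (k x y)) * norm (f y))"
      using F(1) by (simp add: sum_distrib_right sum.If_cases Collect_conj_eq)
    also have "\<dots> \<le> (\<Sum>y\<in>G. C * norm (f y))"
      using G F C by (intro sum_mono mult_right_mono) auto
    also have "\<dots> = C * (\<Sum>y\<in>G. norm (f y))" by (simp add: sum_distrib_left)
    also have "\<dots> \<le> C * L1_norm (count_space X) f"
      by (intro mult_left_mono sum_norm_le_L1_norm f G C)
    finally show ?thesis .
  qed
  show ?thesis
  proof (rule L1_opsI[where K = C])
    fix f assume f: "f \<in> L1 (count_space X)"
    show "kernel_op B k f \<in> L1 (count_space X)"
      "L1_norm (count_space X) (kernel_op B k f) \<le> C * L1_norm (count_space X) f"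
      using L1_count_spaceI[OF *[OF f]] by blast+
  qed (auto simp: kernel_op_def sum.distrib sum_distrib_left algebra_simps)
qed

text \<open>Injectivity ensures that no entry of the column is counted twice. In the factorization
  \<open>s\<close> is once the numbering of a ball and once its inverse.\<close>

lemma sum_L1_column_le:
  assumes a: "a \<in> L1_ops (count_space X)" and F: "finite F" and s: "s ` F \<subseteq> X" "inj_on s F"
  shows "(\<Sum>l\<in>F. norm (a (delta y) (s l))) \<le> L1_norm (count_space X) (a (delta y))"
proof -
  have "(\<Sum>l\<in>F. norm (a (delta y) (s l))) = (\<Sum>x\<in>s ` F. norm (a (delta y) x))"
    using s by (simp add: sum.reindex)
  also have "\<dots> \<le> L1_norm (count_space X) (a (delta y))"
    using F s by (intro sum_norm_le_L1_norm L1_ops_L1[OF a] delta_in_L1) auto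
  finally show ?thesis .
qed

section \<open>Finite approximation\<close>

text \<open>Rounding real and imaginary parts down to a grid leaves, by boundedness, finitely many
  patterns over \<open>J\<close>. Points with the same pattern form a class; \<open>c\<close>
  numbers the classes and \<open>r\<close> picks a point in each.\<close>

lemma finite_partition_approx:
  fixes g :: "'t \<Rightarrow> 'a \<Rightarrow> complex"
  assumes J: "finite J" and C: "\<And>t y. t \<in> J \<Longrightarrow> y \<in> X \<Longrightarrow> norm (g t y) \<le> C t" and \<delta>: "\<delta> > 0"
  obtains c and k :: nat and r where "\<forall>y\<in>X. c y < k" "\<forall>p<k. r p \<in> X"
    "\<forall>t\<in>J. \<forall>y\<in>X. norm (g t y - g t (r (c y))) \<le> \<delta>"
proof -
  \<comment> \<open>Real and imaginary part each contribute at most one mesh width to the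
    error.\<close>
  define \<eta> where "\<eta> = \<delta> / 2"
  have \<eta>: "\<eta> > 0" using \<delta> by (simp add: \<eta>_def)
  define q where "q t y = (\<lfloor>Re (g t y) / \<eta>\<rfloor>, \<lfloor>Im (g t y) / \<eta>\<rfloor>)" for t y
  \<comment> \<open>\<open>restrict\<close> fixes the values outside \<open>J\<close>, so the
    patterns lie in a finite product of finite sets.\<close>
  define Q where "Q y = restrict (\<lambda>t. q t y) J" for y
  define I where "I t = {\<lfloor>- C t / \<eta>\<rfloor>..\<lfloor>C t / \<eta>\<rfloor>}" for t
  have fl: "\<lfloor>u / \<eta>\<rfloor> \<in> I t" if "\<bar>u\<bar> \<le> C t" for u t
    using that \<eta> unfolding I_def atLeastAtMost_iff
    by (intro conjI floor_mono divide_right_mono) linarith+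
  have "Q ` X \<subseteq> (\<Pi>\<^sub>E t\<in>J. I t \<times> I t)"
  proof clarify
    fix y assume y: "y \<in> X"
    have "q t y \<in> I t \<times> I t" if "t \<in> J" for t
      unfolding q_def mem_Times_iff fst_conv snd_conv
      using C[OF that y] abs_Re_le_cmod[of "g t y"] abs_Im_le_cmod[of "g t y"] by (intro conjI fl) linarith+
    then show "Q y \<in> (\<Pi>\<^sub>E t\<in>J. I t \<times> I t)" unfolding Q_def by (rule restrict_PiE_iff[THEN iffD2, rule_format])
  qed
  moreover have "finite (\<Pi>\<^sub>E t\<in>J. I t \<times> I t)"
    using J by (intro finite_PiE) (auto simp: I_def)
  ultimately have "finite (Q ` X)" by (rule finite_subset)
  then obtain h where h: "bij_betw h (Q ` X) {0..<card (Q ` X)}"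
    using ex_bij_betw_finite_nat by blast
  define c where "c = h \<circ> Q"
  \<comment> \<open>The numbering is onto, so every class number has a representative; for empty
    \<open>X\<close> there are no classes at all.\<close>
  have cX: "c ` X = {..<card (Q ` X)}"
    using bij_betw_imp_surj_on[OF h] by (simp only: c_def image_comp[symmetric] lessThan_atLeast0)
  show thesis
  proof (rule that[of c "card (Q ` X)" "inv_into X c"]; intro ballI allI impI)
    show "c y < card (Q ` X)" if "y \<in> X" for y using that cX by blast
    show "inv_into X c p \<in> X" if "p < card (Q ` X)" for p
      using that cX by (intro inv_into_into) auto
    fix t y assume y: "y \<in> X" and t: "t \<in> J"
    define z where "z = inv_into X c (c y)"
    have z: "z \<in> X" "c z = c y" using y by (auto simp: z_def inv_into_into f_inv_into_f)
    then have "Q z = Q y" using y bij_betw_imp_inj_on[OF h] by (auto simp: c_def dest: inj_onD)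
    then have "q t z = q t y" using t by (metis Q_def restrict_apply')
    then have fleq: "\<lfloor>Re (g t z) / \<eta>\<rfloor> = \<lfloor>Re (g t y) / \<eta>\<rfloor>" "\<lfloor>Im (g t z) / \<eta>\<rfloor> = \<lfloor>Im (g t y) / \<eta>\<rfloor>"
      by (auto simp: q_def)
    have close: "\<bar>u - v\<bar> \<le> \<eta>" if "\<lfloor>v / \<eta>\<rfloor> = \<lfloor>u / \<eta>\<rfloor>" for u v
    proof -
      have "\<bar>u / \<eta> - v / \<eta>\<bar> \<le> 1" using that by linarith
      then show ?thesis using \<eta> by (simp add: diff_divide_distrib[symmetric] abs_divide)
    qed
    have "norm (g t y - g t z) \<le> \<bar>Re (g t y - g t z)\<bar> + \<bar>Im (g t y - g t z)\<bar>" by (rule cmod_le)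
    also have "\<dots> \<le> \<eta> + \<eta>" using fleq by (intro add_mono) (auto intro: close)
    finally show "norm (g t y - g t (inv_into X c (c y))) \<le> \<delta>" by (simp add: z_def \<eta>_def)
  qed
qed

section \<open>Finite propagation and the uniform Roe algebra\<close>

context Metric_space
begin

definition finite_propagation_ops :: "'a fn_op set" where
  "finite_propagation_ops = {T \<in> L1_ops (count_space M). propagation T < \<infinity>}"

text \<open>Supplies a real radius, as bounded geometry and the triangle inequality want it. It is
  the supremum itself, which \<open>enn2real\<close> does not distort when it is finite.\<close>

lemma propagation_finite_iff:
  "propagation T < \<infinity> \<longleftrightarrow> (\<exists>R\<ge>0. \<forall>x\<in>M. \<forall>y\<in>M. coefficient T x y \<noteq> 0 \<longrightarrow> d x y \<le> R)"
proof
  assume fin: "propagation T < \<infinity>"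
  have "d x y \<le> enn2real (propagation T)" if "x \<in> M" "y \<in> M" "coefficient T x y \<noteq> 0" for x y
  proof -
    have "ennreal (d x y) \<le> propagation T"
      unfolding propagation_def using that by (intro Sup_upper) blast
    then have "enn2real (ennreal (d x y)) \<le> enn2real (propagation T)"
      using fin by (intro enn2real_mono) auto
    then show ?thesis by simp
  qed
  then show "\<exists>R\<ge>0. \<forall>x\<in>M. \<forall>y\<in>M. coefficient T x y \<noteq> 0 \<longrightarrow> d x y \<le> R"
    using enn2real_nonneg by blast
next
  assume "\<exists>R\<ge>0. \<forall>x\<in>M. \<forall>y\<in>M. coefficient T x y \<noteq> 0 \<longrightarrow> d x y \<le> R"
  then obtain R where "\<forall>x\<in>M. \<forall>y\<in>M. coefficient T x y \<noteq> 0 \<longrightarrow> d x y \<le> R" by blast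
  then have "propagation T \<le> ennreal R"
    unfolding propagation_def by (intro Sup_least) (auto intro: ennreal_leI)
  then show "propagation T < \<infinity>" using ennreal_less_top le_less_trans by (metis infinity_ennreal_def)
qed

lemma finite_propagation_ops_iff:
  "T \<in> finite_propagation_ops \<longleftrightarrow> T \<in> L1_ops (count_space M) \<and>
    (\<exists>R\<ge>0. \<forall>x\<in>M. \<forall>y\<in>M. T (delta y) x \<noteq> 0 \<longrightarrow> d x y \<le> R)"
  unfolding finite_propagation_ops_def propagation_finite_iff coefficient_def by blast

lemma uniform_Roe_algebra_1_eq:
  "uniform_Roe_algebra_1 = L1_op_closure (count_space M) finite_propagation_ops"
  by (simp add: uniform_Roe_algebra_1_def finite_propagation_ops_def)

lemma finite_propagation_ops_subset: "finite_propagation_ops \<subseteq> L1_ops (count_space M)"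
  by (auto simp: finite_propagation_ops_def)

text \<open>By bounded geometry the support of \<open>T (delta y)\<close> in \<open>M\<close> lies
  in a finite ball, so \<open>S\<close> acts on it through a finite sum. A nonzero coefficient of
  the product then has an intermediate point \<open>z\<close>, and the triangle inequality gives
  \<open>R + R'\<close>.\<close>

lemma finite_propagation_ops_comp:
  assumes bg: bounded_geometry
    and S: "S \<in> finite_propagation_ops" and T: "T \<in> finite_propagation_ops"
  shows "S \<circ> T \<in> finite_propagation_ops"
proof -
  have S': "S \<in> L1_ops (count_space M)" and T': "T \<in> L1_ops (count_space M)"
    using S T finite_propagation_ops_subset by auto
  obtain R where R: "R \<ge> 0" "\<And>x y. x \<in> M \<Longrightarrow> y \<in> M \<Longrightarrow> S (delta y) x \<noteq> 0 \<Longrightarrow> d x y \<le> R"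
    using S unfolding finite_propagation_ops_iff by blast
  obtain R' where R': "R' \<ge> 0" "\<And>x y. x \<in> M \<Longrightarrow> y \<in> M \<Longrightarrow> T (delta y) x \<noteq> 0 \<Longrightarrow> d x y \<le> R'"
    using T unfolding finite_propagation_ops_iff by blast
  have "d x y \<le> R + R'" if xy: "x \<in> M" "y \<in> M" and nz: "(S \<circ> T) (delta y) x \<noteq> 0" for x y
  proof -
    let ?B = "mcball y R'"
    have fin: "finite ?B" using bg R'(1) xy(2) unfolding bounded_geometry_def by blast
    have expand: "T (delta y) u = (\<Sum>z\<in>?B. T (delta y) z * delta z u)" if "u \<in> M" for u
      unfolding finite_restrict_eq_sum_delta[OF fin, of u "T (delta y)", symmetric]
      using R'(2)[OF that xy(2)] that xy(2) by (auto simp: commute)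
    \<comment> \<open>The expansion holds at points of \<open>M\<close>, while values elsewhere are
      unconstrained; it therefore passes through \<open>S\<close> as an almost everywhere
      equality.\<close>
    have "AE u in count_space M. S (T (delta y)) u = S (\<lambda>u. \<Sum>z\<in>?B. T (delta y) z * delta z u) u"
      by (rule L1_ops_cong_AE[OF S' L1_ops_L1[OF T' delta_in_L1] L1_sum[OF L1_scale[OF delta_in_L1]]])
         (unfold AE_count_space, use expand in blast)
    then have "S (T (delta y)) x = S (\<lambda>u. \<Sum>z\<in>?B. T (delta y) z * delta z u) x"
      using xy(1) unfolding AE_count_space by blast
    also have "\<dots> = (\<Sum>z\<in>?B. T (delta y) z * S (delta z) x)"
      by (rule L1_ops_finite_support[OF S' fin xy(1)])
    finally have "(\<Sum>z\<in>?B. T (delta y) z * S (delta z) x) \<noteq> 0" using nz by simp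
    then obtain z where "z \<in> ?B" "T (delta y) z * S (delta z) x \<noteq> 0"
      by (rule sum.not_neutral_contains_not_neutral)
    then have z: "z \<in> ?B" "S (delta z) x \<noteq> 0" by auto
    then have "d x z \<le> R" "d y z \<le> R'" "z \<in> M" using R(2) xy by auto
    then show ?thesis using triangle[OF xy(1) _ xy(2), of z] commute[of y z] by linarith
  qed
  moreover have "R + R' \<ge> 0" using R R' by simp
  ultimately show ?thesis
    unfolding finite_propagation_ops_iff using L1_ops_comp[OF S' T'] by blast
qed

lemma L1_operator_algebra_uniform_Roe:
  assumes bg: bounded_geometry
  shows "L1_operator_algebra (count_space M) uniform_Roe_algebra_1"
  unfolding uniform_Roe_algebra_1_eq
proof (rule L1_operator_algebra_closure[OF finite_propagation_ops_subset])
  have "(\<lambda>f x. 0) \<in> L1_ops (count_space M)"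
    by (rule L1_opsI[where K = 0]) (auto simp: L1_zero L1_norm_zero)
  then have "(\<lambda>f x. 0) \<in> finite_propagation_ops"
    unfolding finite_propagation_ops_iff by auto
  then show "finite_propagation_ops \<noteq> {}" by blast
  fix S T assume S: "S \<in> finite_propagation_ops" and T: "T \<in> finite_propagation_ops"
  show "S \<circ> T \<in> finite_propagation_ops" by (rule finite_propagation_ops_comp[OF bg S T])
  obtain R where R: "R \<ge> 0" "\<And>x y. x \<in> M \<Longrightarrow> y \<in> M \<Longrightarrow> S (delta y) x \<noteq> 0 \<Longrightarrow> d x y \<le> R"
    using S unfolding finite_propagation_ops_iff by blast
  obtain R' where R': "R' \<ge> 0" "\<And>x y. x \<in> M \<Longrightarrow> y \<in> M \<Longrightarrow> T (delta y) x \<noteq> 0 \<Longrightarrow> d x y \<le> R'"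
    using T unfolding finite_propagation_ops_iff by blast
  have "d x y \<le> max R R'" if "x \<in> M" "y \<in> M" "op_add S T (delta y) x \<noteq> 0" for x y
    using that R(2)[of x y] R'(2)[of x y]
    by (cases "S (delta y) x = 0") (auto simp: op_add_def le_max_iff_disj)
  moreover have "max R R' \<ge> 0" using R by simp
  moreover have "op_add S T \<in> L1_ops (count_space M)"
    using S T finite_propagation_ops_subset by (auto intro: L1_ops_op_add)
  ultimately show "op_add S T \<in> finite_propagation_ops"
    unfolding finite_propagation_ops_iff by blast
next
  fix c T assume "T \<in> finite_propagation_ops"
  then show "op_scale c T \<in> finite_propagation_ops"
    unfolding finite_propagation_ops_iff by (auto simp: L1_ops_op_scale) (auto simp: op_scale_def)
qed

section \<open>Numbered balls and factorization through matrices\<close>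

text \<open>One \<open>N\<close> serves all centres, so columns supported in different balls become
  vectors over the same index set and can be compared.\<close>

lemma bounded_geometry_index:
  assumes bg: bounded_geometry and R: "R \<ge> 0"
  obtains N :: nat and ix :: "'a \<Rightarrow> 'a \<Rightarrow> nat" where
    "\<And>y. y \<in> M \<Longrightarrow> inj_on (ix y) (mcball y R)"
    "\<And>y. y \<in> M \<Longrightarrow> ix y ` mcball y R \<subseteq> {..<N}"
    "\<And>y. y \<in> M \<Longrightarrow> finite (mcball y R) \<and> card (mcball y R) \<le> N"
proof -
  obtain N where N: "\<forall>y\<in>M. finite (mcball y R) \<and> card (mcball y R) \<le> N"
    using bg R unfolding bounded_geometry_def by blast
  have "\<forall>y\<in>M. \<exists>h. inj_on h (mcball y R) \<and> h ` mcball y R \<subseteq> {..<N}"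
  proof
    fix y assume "y \<in> M"
    then have fin: "finite (mcball y R)" and le: "card (mcball y R) \<le> N" using N by auto
    obtain h where "bij_betw h (mcball y R) {0..<card (mcball y R)}"
      using ex_bij_betw_finite_nat[OF fin] by blast
    then show "\<exists>h. inj_on h (mcball y R) \<and> h ` mcball y R \<subseteq> {..<N}"
      using le by (intro exI[of _ h]) (auto simp: bij_betw_def)
  qed
  then obtain ix where "\<forall>y\<in>M. inj_on (ix y) (mcball y R) \<and> ix y ` mcball y R \<subseteq> {..<N}"
    by (rule bchoice[THEN exE])
  with N that show thesis by blast
qed

text \<open>Approximate \<open>a\<close> by an operator \<open>S\<close> of finite propagation.
  Beyond the radius of \<open>S\<close> its columns vanish, so there the column of \<open>a\<close>
  is a column of \<open>a - S\<close>, whose norm is at most \<open>e\<close>.\<close>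

lemma uniform_Roe_column_tails:
  assumes F: "finite F" "F \<subseteq> uniform_Roe_algebra_1" and e: "e > 0"
  obtains R where "R \<ge> 0"
    "\<And>a y G. a \<in> F \<Longrightarrow> y \<in> M \<Longrightarrow> finite G \<Longrightarrow> G \<subseteq> M - mcball y R \<Longrightarrow>
      (\<Sum>x\<in>G. norm (a (delta y) x)) \<le> e"
proof -
  let ?M = "count_space M"
  have "\<exists>R\<ge>0. \<forall>y\<in>M. \<forall>G. finite G \<longrightarrow> G \<subseteq> M - mcball y R \<longrightarrow> (\<Sum>x\<in>G. norm (a (delta y) x)) \<le> e"
    if "a \<in> F" for a
  proof -
    have a: "a \<in> L1_op_closure ?M finite_propagation_ops"
      using that F by (auto simp: uniform_Roe_algebra_1_eq)
    obtain S where S: "S \<in> finite_propagation_ops"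
      and aS: "\<And>f. f \<in> L1 ?M \<Longrightarrow> L1_norm ?M (\<lambda>x. a f x - S f x) \<le> e * L1_norm ?M f"
      using a e unfolding L1_op_closure_iff[OF finite_propagation_ops_subset] by blast
    have ops: "a \<in> L1_ops ?M" "S \<in> L1_ops ?M"
      using a S finite_propagation_ops_subset by (auto simp: L1_op_closure_def)
    obtain R where R: "R \<ge> 0" "\<And>x y. x \<in> M \<Longrightarrow> y \<in> M \<Longrightarrow> S (delta y) x \<noteq> 0 \<Longrightarrow> d x y \<le> R"
      using S unfolding finite_propagation_ops_iff by blast
    have "(\<Sum>x\<in>G. norm (a (delta y) x)) \<le> e"
      if y: "y \<in> M" and G: "finite G" "G \<subseteq> M - mcball y R" for y G
    proof -
      have "(\<Sum>x\<in>G. norm (a (delta y) x)) = (\<Sum>x\<in>G. norm (a (delta y) x - S (delta y) x))"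
      proof (rule sum.cong[OF refl])
        fix x assume "x \<in> G"
        then have "x \<in> M" "\<not> d x y \<le> R" using G y by (auto simp: commute)
        then have "S (delta y) x = 0" using R(2) y by blast
        then show "norm (a (delta y) x) = norm (a (delta y) x - S (delta y) x)" by simp
      qed
      also have "\<dots> \<le> L1_norm ?M (\<lambda>x. a (delta y) x - S (delta y) x)"
        using G by (intro sum_norm_le_L1_norm L1_diff L1_ops_L1[OF ops(1)] L1_ops_L1[OF ops(2)] delta_in_L1) auto
      also have "\<dots> \<le> e * L1_norm ?M (delta y)" by (intro aS delta_in_L1)
      also have "\<dots> \<le> e" using mult_left_mono[OF L1_norm_delta[of M y], of e] e by simp
      finally show ?thesis .
    qed
    with R(1) show ?thesis by blast
  qed
  then obtain R where R: "\<And>a. a \<in> F \<Longrightarrow> R a \<ge> 0"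
    "\<And>a y G. a \<in> F \<Longrightarrow> y \<in> M \<Longrightarrow> finite G \<Longrightarrow> G \<subseteq> M - mcball y (R a) \<Longrightarrow>
      (\<Sum>x\<in>G. norm (a (delta y) x)) \<le> e"
    by metis
  show thesis
  \<comment> \<open>The sum dominates every \<open>R a\<close> and, unlike a maximum, also makes
    sense for empty \<open>F\<close>.\<close>
  proof (rule that[of "\<Sum>a\<in>F. R a"])
    show "(\<Sum>a\<in>F. R a) \<ge> 0" using R(1) by (rule sum_nonneg)
    fix a y G assume a: "a \<in> F" and yG: "y \<in> M" "finite G" "G \<subseteq> M - mcball y (\<Sum>a\<in>F. R a)"
    have "R a \<le> (\<Sum>a\<in>F. R a)" using R(1) F(1) a by (intro member_le_sum) auto
    then have "G \<subseteq> M - mcball y (R a)" using yG(3) by auto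
    with R(2) a yG show "(\<Sum>x\<in>G. norm (a (delta y) x)) \<le> e" by blast
  qed
qed

text \<open>Provides the maps at one index of the net. Each column carries an error of at most
  \<open>e / 4\<close> outside its ball and \<open>e / 4\<close> inside; the total
  \<open>e / 2\<close> leaves room for the strict inequality.\<close>

lemma uniform_Roe_finite_factorization:
  assumes bg: bounded_geometry
    and F: "finite F" "F \<subseteq> uniform_Roe_algebra_1" and e: "e > 0"
  obtains n \<phi> \<psi> where "n \<ge> 1"
    "complete_contraction_1 (count_space M) uniform_Roe_algebra_1 (fin_measure n) (M1 n) \<phi>"
    "complete_contraction_1 (fin_measure n) (M1 n) (count_space M) uniform_Roe_algebra_1 \<psi>"
    "\<And>a. a \<in> F \<Longrightarrow> L1_opnorm (count_space M) (op_diff (\<psi> (\<phi> a)) a) < e"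
proof -
  let ?M = "count_space M"
  let ?A = "uniform_Roe_algebra_1"
  have A: "?A \<subseteq> L1_ops ?M" by (auto simp: uniform_Roe_algebra_1_eq L1_op_closure_def)
  obtain R where R: "R \<ge> 0"
    and tail: "\<And>a y G. a \<in> F \<Longrightarrow> y \<in> M \<Longrightarrow> finite G \<Longrightarrow> G \<subseteq> M - mcball y R \<Longrightarrow>
      (\<Sum>x\<in>G. norm (a (delta y) x)) \<le> e / 4"
    using uniform_Roe_column_tails[OF F, of "e / 4"] e by auto
  obtain N ix where ix: "\<And>y. y \<in> M \<Longrightarrow> inj_on (ix y) (mcball y R)"
    "\<And>y. y \<in> M \<Longrightarrow> ix y ` mcball y R \<subseteq> {..<N::nat}"
    and N: "\<And>y. y \<in> M \<Longrightarrow> finite (mcball y R) \<and> card (mcball y R) \<le> N"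
    by (rule bounded_geometry_index[OF bg R]) blast
  \<comment> \<open>The column at \<open>y\<close>, cut off to its ball, is transported to
    \<open>{..<N}\<close>; numbers that name no point of the ball receive \<open>0\<close>.\<close>
  define g where "g a l y =
    (if l \<in> ix y ` mcball y R then a (delta y) (inv_into (mcball y R) (ix y) l) else 0)"
    for a :: "'a fn_op" and l y
  have g_ix: "g a (ix y x) y = a (delta y) x" if "y \<in> M" "x \<in> mcball y R" for a x y
    using that ix(1) by (simp add: g_def)
  have g_sum: "(\<Sum>l\<in>L. norm (g a l y)) \<le> L1_norm ?M (a (delta y))"
    if a: "a \<in> L1_ops ?M" and y: "y \<in> M" and L: "finite L" for a y L
  proof -
    have "(\<Sum>l\<in>L. norm (g a l y)) =
        (\<Sum>l\<in>L \<inter> ix y ` mcball y R. norm (a (delta y) (inv_into (mcball y R) (ix y) l)))"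
      using L by (intro sum.mono_neutral_cong_right) (auto simp: g_def)
    also have "\<dots> \<le> L1_norm ?M (a (delta y))"
    proof (rule sum_L1_column_le[OF a])
      show "inv_into (mcball y R) (ix y) ` (L \<inter> ix y ` mcball y R) \<subseteq> M"
        using ix(1)[OF y] by auto
      show "inj_on (inv_into (mcball y R) (ix y)) (L \<inter> ix y ` mcball y R)"
        by (rule inj_on_inv_into) auto
    qed (use L in auto)
    finally show ?thesis .
  qed
  note col = L1_norm_column_le_opnorm
  \<comment> \<open>At most \<open>N\<close> entries of a column in its ball are each off by
    \<delta>, together at most \<open>e / 4\<close>; the \<open>1\<close> covers
    \<open>N = 0\<close>.\<close>
  define \<delta> where "\<delta> = e / (4 * (real N + 1))"
  have \<delta>: "\<delta> > 0" "real N * \<delta> \<le> e / 4" using e by (auto simp: \<delta>_def field_simps)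
  \<comment> \<open>The partition is made for pairs of an operator in \<open>F\<close> and a number
    below \<open>N\<close>, so the same classes serve all operators and all coordinates.\<close>
  have fin: "finite (F \<times> {..<N})" using F(1) by simp
  have bound: "norm (g (fst t) (snd t) y) \<le> L1_opnorm ?M (fst t)"
    if t: "t \<in> F \<times> {..<N}" and y: "y \<in> M" for t y
  proof -
    have a: "fst t \<in> L1_ops ?M" using t F A by auto
    show ?thesis using g_sum[OF a y, of "{snd t}"] col[OF a, of y] by simp
  qed
  obtain c and k :: nat and r where ck: "\<forall>y\<in>M. c y < k" and rM: "\<forall>p<k. r p \<in> M"
    and nr: "\<forall>t\<in>F \<times> {..<N}. \<forall>y\<in>M.
      norm (g (fst t) (snd t) y - g (fst t) (snd t) (r (c y))) \<le> \<delta>"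
    by (rule finite_partition_approx[of "F \<times> {..<N}" M "\<lambda>t. g (fst t) (snd t)", OF fin bound \<delta>(1)])
  have c: "c y < k" if "y \<in> M" for y using ck that by blast
  have r: "r p \<in> M" if "p < k" for p using rM that by blast
  have near: "norm (g a l y - g a l (r (c y))) \<le> \<delta>" if "y \<in> M" "a \<in> F" "l < N" for a l y
    using nr[rule_format, of "(a, l)" y] that by simp
  \<comment> \<open>One square size must hold the row numbers below \<open>N\<close> and the class
    numbers below \<open>k\<close>; \<open>Suc\<close> keeps it positive.\<close>
  define n where "n = Suc (N + k)"
  define \<phi> where "\<phi> a = kernel_op (\<lambda>_. {..<k}) (\<lambda>l p. g a l (r p))" for a
  \<comment> \<open>The number of \<open>x\<close> is taken in the ball about the column index
    \<open>y\<close>. Distinct \<open>x\<close> in one column thus read distinct entries of column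
    \<open>c y\<close> of \<open>S\<close>, and the column norm cannot grow.\<close>
  define \<psi> where "\<psi> S = kernel_op (\<lambda>x. mcball x R) (\<lambda>x y. S (delta (c y)) (ix y x))" for S :: "nat fn_op"
  have \<phi>_delta: "\<phi> a (delta p) l = (if p < k then g a l (r p) else 0)" for a p l
    by (simp add: \<phi>_def kernel_op_delta)
  have \<psi>_delta: "\<psi> S (delta y) x = (if y \<in> mcball x R then S (delta (c y)) (ix y x) else 0)"
    if "x \<in> M" for S x y
    unfolding \<psi>_def using N[OF that] by (subst kernel_op_delta) auto
  have \<phi>_M1: "\<phi> a \<in> M1 n" if "a \<in> ?A" for a
    unfolding M1_def \<phi>_def
  proof (rule kernel_op_in_L1_ops[where C = "L1_opnorm ?M a"])
    have a: "a \<in> L1_ops ?M" using that A by blast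
    show "L1_opnorm ?M a \<ge> 0" by (rule L1_opnorm_nonneg[OF a])
    fix p and L :: "nat set" assume L: "finite L"
    show "(\<Sum>l | l \<in> L \<and> p \<in> {..<k}. norm (g a l (r p))) \<le> L1_opnorm ?M a"
    proof (cases "p < k")
      case True
      then show ?thesis using order_trans[OF g_sum[OF a r[OF True] L] col[OF a]] by simp
    qed (simp add: L1_opnorm_nonneg[OF a])
  qed (auto simp: n_def)
  have \<psi>_sum: "(\<Sum>x | x \<in> G \<and> y \<in> mcball x R. norm (S (delta (c y)) (ix y x)))
      \<le> L1_norm (fin_measure n) (S (delta (c y)))"
    if S: "S \<in> M1 n" and y: "y \<in> M" and G: "finite G" for S y G
  proof (rule sum_L1_column_le)
    have sub: "{x. x \<in> G \<and> y \<in> mcball x R} \<subseteq> mcball y R" by (auto simp: commute)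
    show "inj_on (ix y) {x. x \<in> G \<and> y \<in> mcball x R}" using ix(1)[OF y] sub by (rule inj_on_subset)
    show "ix y ` {x. x \<in> G \<and> y \<in> mcball x R} \<subseteq> {..<n}"
    proof -
      have "ix y ` {x. x \<in> G \<and> y \<in> mcball x R} \<subseteq> {..<N}"
        using image_mono[OF sub] ix(2)[OF y] by (rule order_trans)
      also have "\<dots> \<subseteq> {..<n}" by (auto simp: n_def)
      finally show ?thesis .
    qed
  qed (use S G in \<open>auto simp: M1_def\<close>)
  have \<psi>_ops: "\<psi> S \<in> L1_ops ?M" if S: "S \<in> M1 n" for S
    unfolding \<psi>_def
  proof (rule kernel_op_in_L1_ops[where C = "L1_opnorm (fin_measure n) S"])
    have S': "S \<in> L1_ops (fin_measure n)" using S by (simp add: M1_def)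
    show "L1_opnorm (fin_measure n) S \<ge> 0" by (rule L1_opnorm_nonneg[OF S'])
    fix y and G :: "'a set" assume "y \<in> M" "finite G"
    from order_trans[OF \<psi>_sum[OF S this] col[OF S']]
    show "(\<Sum>x | x \<in> G \<and> y \<in> mcball x R. norm (S (delta (c y)) (ix y x))) \<le> L1_opnorm (fin_measure n) S" .
  qed (use N in auto)
  have \<psi>_A: "\<psi> S \<in> ?A" if S: "S \<in> M1 n" for S
  proof -
    \<comment> \<open>Entries at distance more than \<open>R\<close> vanish, whatever
      \<open>S\<close> is.\<close>
    have "\<psi> S \<in> finite_propagation_ops"
      unfolding finite_propagation_ops_iff using \<psi>_ops[OF S] R
      by (auto simp: \<psi>_delta intro!: exI[of _ R] split: if_splits)
    then show ?thesis
      unfolding uniform_Roe_algebra_1_eq using L1_op_closure_subset[OF finite_propagation_ops_subset] by blast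
  qed
  show thesis
  proof (rule that)
    show "n \<ge> 1" by (simp add: n_def)
    show "complete_contraction_1 ?M ?A (fin_measure n) (M1 n) \<phi>"
    proof (rule complete_contraction_1_of_columns[OF A _ \<phi>_M1])
      show "M1 n \<subseteq> L1_ops (fin_measure n)" by (simp add: M1_def)
      have "g (op_add a b) l y = g a l y + g b l y" for a b l y by (simp add: g_def op_add_def)
      then show "\<phi> (op_add a b) = op_add (\<phi> a) (\<phi> b)" for a b
        by (simp add: \<phi>_def kernel_op_add)
      have "g (op_scale z a) l y = z * g a l y" for z a l y by (simp add: g_def op_scale_def)
      then show "\<phi> (op_scale z a) = op_scale z (\<phi> a)" for z a
        by (simp add: \<phi>_def kernel_op_scale)
      fix p
      show "(\<forall>a\<in>?A. L1_norm (fin_measure n) (\<phi> a (delta p)) \<le> 0) \<or>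
        (\<exists>x\<in>M. \<forall>a\<in>?A. L1_norm (fin_measure n) (\<phi> a (delta p)) \<le> L1_norm ?M (a (delta x)))"
      proof (cases "p < k")
        case True
        have "L1_norm (fin_measure n) (\<phi> a (delta p)) \<le> L1_norm ?M (a (delta (r p)))" if "a \<in> ?A" for a
        proof (rule L1_count_spaceI)
          fix L :: "nat set" assume "finite L"
          with that A show "(\<Sum>l\<in>L. norm (\<phi> a (delta p) l)) \<le> L1_norm ?M (a (delta (r p)))"
            using True g_sum[OF _ r[OF True]] by (auto simp: \<phi>_delta)
        qed
        with r[OF True] show ?thesis by blast
      next
        case False
        \<comment> \<open>Columns beyond the \<open>k\<close> classes are zero. For empty
          \<open>M\<close> the representatives force \<open>k = 0\<close>, and this is the only
          case.\<close>
        then have "\<phi> a (delta p) = (\<lambda>l. 0)" for a by (simp add: \<phi>_delta fun_eq_iff)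
        then show ?thesis by (simp add: L1_norm_zero)
      qed
    qed
    show "complete_contraction_1 (fin_measure n) (M1 n) ?M ?A \<psi>"
    proof (rule complete_contraction_1_of_columns[OF _ A \<psi>_A])
      show "M1 n \<subseteq> L1_ops (fin_measure n)" by (simp add: M1_def)
      show "\<psi> (op_add S T) = op_add (\<psi> S) (\<psi> T)" for S T
        unfolding \<psi>_def kernel_op_add[symmetric] by (simp add: op_add_def)
      show "\<psi> (op_scale z S) = op_scale z (\<psi> S)" for z S
        unfolding \<psi>_def kernel_op_scale[symmetric] by (simp add: op_scale_def)
      fix y assume y: "y \<in> M"
      have "L1_norm ?M (\<psi> S (delta y)) \<le> L1_norm (fin_measure n) (S (delta (c y)))" if S: "S \<in> M1 n" for S
      proof (rule L1_count_spaceI)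
        fix G assume G: "finite G" "G \<subseteq> M"
        have "(\<Sum>x\<in>G. norm (\<psi> S (delta y) x)) = (\<Sum>x | x \<in> G \<and> y \<in> mcball x R. norm (S (delta (c y)) (ix y x)))"
        proof (rule sum.mono_neutral_cong_right)
          show "\<forall>x\<in>G - {x. x \<in> G \<and> y \<in> mcball x R}. norm (\<psi> S (delta y) x) = 0"
          proof
            fix x assume "x \<in> G - {x. x \<in> G \<and> y \<in> mcball x R}"
            then have "x \<in> M" "y \<notin> mcball x R" using G by blast+
            then show "norm (\<psi> S (delta y) x) = 0" by (simp add: \<psi>_delta del: in_mcball)
          qed
          show "norm (\<psi> S (delta y) x) = norm (S (delta (c y)) (ix y x))"
            if "x \<in> {x. x \<in> G \<and> y \<in> mcball x R}" for x
          proof -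
            have "x \<in> M" "y \<in> mcball x R" using that G by blast+
            then show ?thesis by (simp add: \<psi>_delta del: in_mcball)
          qed
        qed (use G in auto)
        with \<psi>_sum[OF S y G(1)]
        show "(\<Sum>x\<in>G. norm (\<psi> S (delta y) x)) \<le> L1_norm (fin_measure n) (S (delta (c y)))" by simp
      qed
      \<comment> \<open>Column \<open>c y\<close> is the comparison column, chosen independently of
        \<open>S\<close>.\<close>
      moreover have "c y \<in> {..<n}" using c[OF y] by (simp add: n_def)
      ultimately show "(\<forall>S\<in>M1 n. L1_norm ?M (\<psi> S (delta y)) \<le> 0) \<or>
        (\<exists>p\<in>{..<n}. \<forall>S\<in>M1 n. L1_norm ?M (\<psi> S (delta y)) \<le> L1_norm (fin_measure n) (S (delta p)))"
        by blast
    qed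
    fix a assume a: "a \<in> F"
    then have aA: "a \<in> ?A" and a': "a \<in> L1_ops ?M" using F A by auto
    have "L1_opnorm ?M (op_diff (\<psi> (\<phi> a)) a) \<le> e / 2"
    proof (rule L1_opnorm_le_of_columns)
      show "op_diff (\<psi> (\<phi> a)) a \<in> L1_ops ?M" by (intro L1_ops_op_diff \<psi>_ops \<phi>_M1 aA a')
      show "e / 2 \<ge> 0" using e by simp
      fix y assume y: "y \<in> M"
      show "L1_norm ?M (op_diff (\<psi> (\<phi> a)) a (delta y)) \<le> e / 2"
      proof (rule L1_count_spaceI)
        fix G assume G: "finite G" "G \<subseteq> M"
        let ?t = "\<lambda>x. norm (op_diff (\<psi> (\<phi> a)) a (delta y) x)"
        have "(\<Sum>x\<in>G. ?t x) = (\<Sum>x\<in>G \<inter> mcball y R. ?t x) + (\<Sum>x\<in>G - mcball y R. ?t x)"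
          using G(1) by (rule sum.Int_Diff)
        also have "(\<Sum>x\<in>G - mcball y R. ?t x) = (\<Sum>x\<in>G - mcball y R. norm (a (delta y) x))"
        proof (rule sum.cong[OF refl])
          fix x assume "x \<in> G - mcball y R"
          then have "x \<in> M" "y \<notin> mcball x R" using G y by (auto simp: commute)
          then show "?t x = norm (a (delta y) x)"
            by (simp add: op_diff_def \<psi>_delta del: in_mcball)
        qed
        also have "\<dots> \<le> e / 4" using G by (intro tail[OF a y]) auto
        also have "(\<Sum>x\<in>G \<inter> mcball y R. ?t x) \<le> real (card (G \<inter> mcball y R)) * \<delta>"
        proof (rule sum_bounded_above)
          fix x assume "x \<in> G \<inter> mcball y R"
          then have x: "x \<in> M" "x \<in> mcball y R" "y \<in> mcball x R" using G by (auto simp: commute)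
          have "ix y x < N" using ix(2)[OF y] x(2) by blast
          then have "norm (g a (ix y x) y - g a (ix y x) (r (c y))) \<le> \<delta>"
            by (rule near[OF y a])
          \<comment> \<open>Inside the ball, passing through the matrix replaces the column at
            \<open>y\<close> by that of the representative \<open>r (c y)\<close>, read at the same
            number.\<close>
          moreover have "\<psi> (\<phi> a) (delta y) x = g a (ix y x) (r (c y))"
            using x c[OF y] by (simp add: \<psi>_delta \<phi>_delta del: in_mcball)
          ultimately show "?t x \<le> \<delta>"
            using g_ix[OF y x(2), of a] by (simp add: op_diff_def norm_minus_commute)
        qed
        also have "\<dots> \<le> real N * \<delta>"
        proof -
          have "card (G \<inter> mcball y R) \<le> card (mcball y R)" using N[OF y] by (intro card_mono) auto
          also have "\<dots> \<le> N" using N[OF y] by blast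
          finally show ?thesis using \<delta>(1) by (intro mult_right_mono) auto
        qed
        also note \<delta>(2)
        finally show "(\<Sum>x\<in>G. ?t x) \<le> e / 2" by simp
      qed
    qed
    then show "L1_opnorm ?M (op_diff (\<psi> (\<phi> a)) a) < e" using e by linarith
  qed
qed

end

section \<open>The net of factorizations\<close>

theorem theorem3p9:
  fixes X :: "'a set" and d :: "'a \<Rightarrow> 'a \<Rightarrow> real"
  assumes "Metric_space X d"
    and "Metric_space.mtopology X d = discrete_topology X"
    and "Metric_space.bounded_geometry X d"
  shows "nuclear_1 (count_space X) (Metric_space.uniform_Roe_algebra_1 X d)"
proof -
  interpret Metric_space X d by fact
  let ?A = uniform_Roe_algebra_1
  let ?M = "count_space X"
  \<comment> \<open>An index consists of the finite set on which the approximation is prescribed and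
    a number \<open>k\<close> that sets the tolerance \<open>1 / (k + 1)\<close>; both grow along
    the order.\<close>
  define I where "I = {(F :: 'a fn_op set, k :: nat). finite F \<and> F \<subseteq> ?A}"
  define r where "r = {(\<alpha>, \<beta>). \<alpha> \<in> I \<and> \<beta> \<in> I \<and> fst \<alpha> \<subseteq> fst \<beta> \<and> snd \<alpha> \<le> snd \<beta>}"
  have dir: "directed_preorder I r"
    unfolding directed_preorder_def
  proof (intro conjI ballI)
    show "I \<noteq> {}" by (auto simp: I_def)
    show "preorder_on I r"
      by (auto simp: preorder_on_def refl_on_def trans_def r_def)
    fix \<alpha> \<beta> assume "\<alpha> \<in> I" "\<beta> \<in> I"
    then show "\<exists>\<gamma>\<in>I. (\<alpha>, \<gamma>) \<in> r \<and> (\<beta>, \<gamma>) \<in> r"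
      by (intro bexI[of _ "(fst \<alpha> \<union> fst \<beta>, max (snd \<alpha>) (snd \<beta>))"]) (auto simp: r_def I_def)
  qed
  have "\<forall>\<alpha>\<in>I. \<exists>n \<phi> \<psi>. n \<ge> 1 \<and>
      complete_contraction_1 ?M ?A (fin_measure n) (M1 n) \<phi> \<and>
      complete_contraction_1 (fin_measure n) (M1 n) ?M ?A \<psi> \<and>
      (\<forall>a\<in>fst \<alpha>. L1_opnorm ?M (op_diff (\<psi> (\<phi> a)) a) < 1 / real (Suc (snd \<alpha>)))"
  proof
    fix \<alpha> assume "\<alpha> \<in> I"
    then have "finite (fst \<alpha>)" "fst \<alpha> \<subseteq> ?A" by (auto simp: I_def)
    then obtain n \<phi> \<psi> where "n \<ge> 1" "complete_contraction_1 ?M ?A (fin_measure n) (M1 n) \<phi>"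
      "complete_contraction_1 (fin_measure n) (M1 n) ?M ?A \<psi>"
      "\<And>a. a \<in> fst \<alpha> \<Longrightarrow> L1_opnorm ?M (op_diff (\<psi> (\<phi> a)) a) < 1 / real (Suc (snd \<alpha>))"
      by (rule uniform_Roe_finite_factorization[OF assms(3), where e = "1 / real (Suc (snd \<alpha>))"]) auto
    then show "\<exists>n \<phi> \<psi>. n \<ge> 1 \<and>
      complete_contraction_1 ?M ?A (fin_measure n) (M1 n) \<phi> \<and>
      complete_contraction_1 (fin_measure n) (M1 n) ?M ?A \<psi> \<and>
      (\<forall>a\<in>fst \<alpha>. L1_opnorm ?M (op_diff (\<psi> (\<phi> a)) a) < 1 / real (Suc (snd \<alpha>)))" by blast
  qed
  then obtain n \<phi> \<psi> where fac: "\<And>\<alpha>. \<alpha> \<in> I \<Longrightarrow> n \<alpha> \<ge> 1 \<and>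
      complete_contraction_1 ?M ?A (fin_measure (n \<alpha>)) (M1 (n \<alpha>)) (\<phi> \<alpha>) \<and>
      complete_contraction_1 (fin_measure (n \<alpha>)) (M1 (n \<alpha>)) ?M ?A (\<psi> \<alpha>)"
    and approx: "\<And>\<alpha> a. \<alpha> \<in> I \<Longrightarrow> a \<in> fst \<alpha> \<Longrightarrow>
      L1_opnorm ?M (op_diff (\<psi> \<alpha> (\<phi> \<alpha> a)) a) < 1 / real (Suc (snd \<alpha>))"
    unfolding bchoice_iff by blast
  have conv: "\<exists>\<alpha>\<in>I. \<forall>\<beta>\<in>I. (\<alpha>, \<beta>) \<in> r \<longrightarrow> L1_opnorm ?M (op_diff (\<psi> \<beta> (\<phi> \<beta> a)) a) < e"
    if a: "a \<in> ?A" and e: "e > 0" for a and e :: real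
  proof -
    obtain k where k: "1 / real (Suc k) < e" using e reals_Archimedean by (metis inverse_eq_divide)
    \<comment> \<open>From the index \<open>({a}, k)\<close> onwards, the finite set contains
      \<open>a\<close> and the tolerance is at most \<open>1 / Suc k\<close>.\<close>
    have "L1_opnorm ?M (op_diff (\<psi> \<beta> (\<phi> \<beta> a)) a) < e" if \<beta>: "\<beta> \<in> I" "(({a}, k), \<beta>) \<in> r" for \<beta>
    proof -
      have "a \<in> fst \<beta>" "k \<le> snd \<beta>" using \<beta>(2) by (auto simp: r_def)
      then have "L1_opnorm ?M (op_diff (\<psi> \<beta> (\<phi> \<beta> a)) a) < 1 / real (Suc (snd \<beta>))"
        and "1 / real (Suc (snd \<beta>)) \<le> 1 / real (Suc k)"
        using approx[OF \<beta>(1)] by (auto intro: divide_left_mono)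
      with k show ?thesis by linarith
    qed
    moreover have "({a}, k) \<in> I" using a by (simp add: I_def)
    ultimately show ?thesis by blast
  qed
  show ?thesis
    unfolding nuclear_1_def
    using L1_operator_algebra_uniform_Roe[OF assms(3)] dir fac conv by blast
qed

end
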